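(* Let $(M,F)$ be a complex Finsler space of complex dimension $2$. Then: (i) $K^h_{F,\lambda}(z,\eta)=2\mathbf K$, where $\mathbf K:=-\frac1FJ_{|\bar0}$; (ii) $K^h_{F,\mu}(z,\eta)=2\mathbf W$, where $\mathbf W:=-H_{|\bar s}m^{\bar s}-\frac12H(\bar V+\bar H)-BF\,E_{|\bar s}m^{\bar s}$.
   Context: $M$ is a complex manifold with $\dim_{\mathbb C}M=2$; $T'M$ is its holomorphic tangent bundle with local coordinates $(z^k,\eta^k)_{k=1,2}$; $\widetilde{T'M}$ is $T'M$ minus the zero section. A complex Finsler space $(M,F)$: $F:T'M\to[0,\infty)$ is continuous, $L:=F^2$ is smooth on $\widetilde{T'M}$, $F(z,\eta)=0$ iff $\eta=0$, $F(z,\lambda\eta)=|\lambda|F(z,\eta)$ for all $\lambda\in\mathbb C$, and the Hermitian matrix $g_{i\bar j}:=\partial^2L/\partial\eta^i\partial\bar\eta^j$ is positive definite on $\widetilde{T'M}$. Repeated indices are summed over $\{1,2\}$; everything lives on $\widetilde{T'M}$; bars on indices denote conjugation. $(g^{\bar m i})$ is the inverse matrix: $g^{\bar m i}g_{j\bar m}=\delta^i_j$. Chern–Finsler connection: $\dot\partial_k:=\partial/\partial\eta^k$, $N^k_j:=g^{\bar mk}\frac{\partial g_{l\bar m}}{\partial z^j}\eta^l$, $\delta_k:=\frac{\partial}{\partial z^k}-N^j_k\dot\partial_j$, $\delta_{\bar k}:=\overline{\delta_k}$, $L^i_{jk}:=g^{\bar li}\delta_kg_{j\bar l}$, $C^i_{jk}:=g^{\bar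 li}\dot\partial_kg_{j\bar l}$. Curvature: $R^i_{j\bar hk}:=-\delta_{\bar h}L^i_{jk}-\delta_{\bar h}(N^l_k)C^i_{jl}$, $R_{\bar rj\bar hk}:=g_{i\bar r}R^i_{j\bar hk}$. In a fixed local chart: $l^i:=\eta^i/F$, $l_i:=\frac1Fg_{i\bar j}\bar\eta^j$, $g:=\det(g_{i\bar j})$, $m^1:=-l_2/\sqrt g$, $m^2:=l_1/\sqrt g$, $m_1:=-\sqrt g\,l^2$, $m_2:=\sqrt g\,l^1$, and $\lambda:=l^i\delta_i$, $\mu:=m^i\delta_i$. Put $B:=m_hm^km^jC^h_{jk}$, $J:=l^jl^kl_iL^i_{jk}$, $V:=l^jm^kl_iL^i_{jk}$, $E:=l^jm^km_iL^i_{jk}$, $H:=m^jm^km_iL^i_{jk}$. For a function $f$: $f_{|\bar k}:=\delta_{\bar k}f$, $f_{|\bar0}:=\bar\eta^k\delta_{\bar k}f$, $f_{|\bar s}m^{\bar s}:=m^{\bar s}\delta_{\bar s}f$. The horizontal holomorphic sectional curvatures in directions $\lambda$ and $\mu$ are $K^h_{F,\lambda}:=2R_{\bar rj\bar hk}l^{\bar r}l^jl^{\bar h}l^k$ and $K^h_{F,\mu}:=2R_{\bar rj\bar hk}m^{\bar r}m^jm^{\bar h}m^k$. *)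

theory Defs
  imports "HOL-Analysis.Analysis"
begin

text \<open>A chart is a pair of its domain and its coordinate map; the values of the coordinate
  map outside the domain are irrelevant.\<close>

type_synonym 'a chart = "'a set \<times> ('a \<Rightarrow> complex^2)"

abbreviation chart_inv :: "'a chart \<Rightarrow> complex^2 \<Rightarrow> 'a" where
  "chart_inv c \<equiv> inv_into (fst c) (snd c)"

abbreviation chart_image :: "'a chart \<Rightarrow> (complex^2) set" where
  "chart_image c \<equiv> snd c ` fst c"

definition transition :: "'a chart \<Rightarrow> 'a chart \<Rightarrow> complex^2 \<Rightarrow> complex^2" where
  "transition c d = snd d \<circ> chart_inv c"

text \<open>Holomorphic maps of several variables: the real Frechet derivative exists and is
  complex linear, i.e. given by a complex Jacobian matrix.\<close>

definition holomorphic_map_on :: "(complex^2 \<Rightarrow> complex^2) \<Rightarrow> (complex^2) set \<Rightarrow> bool" where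
  "holomorphic_map_on f S \<longleftrightarrow> (\<forall>z\<in>S. \<exists>D :: complex^2^2. (f has_derivative (\<lambda>v. D *v v)) (at z))"

definition complex_surface :: "'a topology \<Rightarrow> 'a chart set \<Rightarrow> bool" where
  "complex_surface M A \<longleftrightarrow>
     Hausdorff_space M \<and> second_countable M \<and>
     (\<Union>c\<in>A. fst c) = topspace M \<and>
     (\<forall>c\<in>A. openin M (fst c) \<and> open (chart_image c) \<and>
        homeomorphic_map (subtopology M (fst c)) (top_of_set (chart_image c)) (snd c)) \<and>
     (\<forall>c\<in>A. \<forall>d\<in>A. holomorphic_map_on (transition c d) (snd c ` (fst c \<inter> fst d)))"

text \<open>A holomorphic tangent vector at \<open>p\<close> is the family of its components
  \<open>(\<eta>\<^sup>1, \<eta>\<^sup>2)\<close> in all charts around \<open>p\<close>, these being related by the Jacobians of the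
  transition maps. Charts that do not contain \<open>p\<close> get the dummy value 0.\<close>

type_synonym 'a tvec = "'a chart \<Rightarrow> complex^2"

definition tangent_space :: "'a chart set \<Rightarrow> 'a \<Rightarrow> 'a tvec set" where
  "tangent_space A p = {v.
     (\<forall>c. c \<notin> A \<or> p \<notin> fst c \<longrightarrow> v c = 0) \<and>
     (\<forall>c\<in>A. \<forall>d\<in>A. p \<in> fst c \<inter> fst d \<longrightarrow>
        v d = frechet_derivative (transition c d) (at (snd c p)) (v c))}"

definition tangent_bundle :: "'a topology \<Rightarrow> 'a chart set \<Rightarrow> ('a \<times> 'a tvec) set" where
  "tangent_bundle M A = Sigma (topspace M) (tangent_space A)"

text \<open>The point of the tangent bundle with coordinates \<open>(z, \<eta>)\<close> in the chart \<open>c\<close>.\<close>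

definition tangent_point :: "'a chart set \<Rightarrow> 'a chart \<Rightarrow> (complex^2) \<times> (complex^2) \<Rightarrow> 'a \<times> 'a tvec" where
  "tangent_point A c = (\<lambda>(z, \<eta>).
     (chart_inv c z,
      \<lambda>d. if d \<in> A \<and> chart_inv c z \<in> fst d
          then frechet_derivative (transition c d) (at z) \<eta> else 0))"

definition in_chart :: "'a chart set \<Rightarrow> 'a chart \<Rightarrow> ('a \<times> 'a tvec \<Rightarrow> real) \<Rightarrow>
    (complex^2) \<times> (complex^2) \<Rightarrow> real" where
  "in_chart A c F = F \<circ> tangent_point A c"

text \<open>Meant for open sets \<open>S\<close> of a finite-dimensional space.\<close>

fun Ck_on :: "nat \<Rightarrow> ('a::real_normed_vector \<Rightarrow> 'b::real_normed_vector) \<Rightarrow> 'a set \<Rightarrow> bool" where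
  "Ck_on 0 f S \<longleftrightarrow> continuous_on S f"
| "Ck_on (Suc k) f S \<longleftrightarrow> (\<forall>x\<in>S. f differentiable (at x)) \<and>
     (\<forall>v. Ck_on k (\<lambda>x. frechet_derivative f (at x) v) S)"

definition smooth_on :: "('a::real_normed_vector \<Rightarrow> 'b::real_normed_vector) \<Rightarrow> 'a set \<Rightarrow> bool" where
  "smooth_on f S \<longleftrightarrow> (\<forall>k. Ck_on k f S)"

type_synonym point = "(complex^2) \<times> (complex^2)"

text \<open>Wirtinger derivatives: \<open>axis k 1\<close> and \<open>axis k \<i>\<close> are the directions of the real and of the
  imaginary part of the coordinate with index \<open>k\<close>.\<close>

definition dz :: "2 \<Rightarrow> (point \<Rightarrow> complex) \<Rightarrow> point \<Rightarrow> complex" where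
  "dz k f p = (frechet_derivative f (at p) (axis k 1, 0)
               - \<i> * frechet_derivative f (at p) (axis k \<i>, 0)) / 2"

definition dzbar :: "2 \<Rightarrow> (point \<Rightarrow> complex) \<Rightarrow> point \<Rightarrow> complex" where
  "dzbar k f p = (frechet_derivative f (at p) (axis k 1, 0)
                  + \<i> * frechet_derivative f (at p) (axis k \<i>, 0)) / 2"

definition deta :: "2 \<Rightarrow> (point \<Rightarrow> complex) \<Rightarrow> point \<Rightarrow> complex" where
  "deta k f p = (frechet_derivative f (at p) (0, axis k 1)
                 - \<i> * frechet_derivative f (at p) (0, axis k \<i>)) / 2"

definition detabar :: "2 \<Rightarrow> (point \<Rightarrow> complex) \<Rightarrow> point \<Rightarrow> complex" where
  "detabar k f p = (frechet_derivative f (at p) (0, axis k 1)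
                    + \<i> * frechet_derivative f (at p) (0, axis k \<i>)) / 2"

text \<open>From here on, \<open>F\<close> with argument type \<^typ>\<open>point\<close> is the expression of a Finsler
  function in a fixed chart.\<close>

text \<open>\<open>gm F i j\<close> is \<open>g\<close> with lower indices \<open>i\<close>, \<open>j\<close>-bar.\<close>

definition gm :: "(point \<Rightarrow> real) \<Rightarrow> 2 \<Rightarrow> 2 \<Rightarrow> point \<Rightarrow> complex" where
  "gm F i j = deta i (detabar j (\<lambda>p. complex_of_real ((F p)\<^sup>2)))"

definition gmat :: "(point \<Rightarrow> real) \<Rightarrow> point \<Rightarrow> complex^2^2" where
  "gmat F p = (\<chi> i j. gm F i j p)"

definition hermitian_pos_def :: "complex^2^2 \<Rightarrow> bool" where
  "hermitian_pos_def G \<longleftrightarrow> (\<forall>i j. G $ j $ i = cnj (G $ i $ j)) \<and>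
     (\<forall>\<xi> :: complex^2. \<xi> \<noteq> 0 \<longrightarrow>
        0 < Re (\<Sum>i\<in>UNIV. \<Sum>j\<in>UNIV. G $ i $ j * \<xi> $ i * cnj (\<xi> $ j)))"

definition complex_finsler_function ::
    "'a topology \<Rightarrow> 'a chart set \<Rightarrow> ('a \<times> 'a tvec \<Rightarrow> real) \<Rightarrow> bool" where
  "complex_finsler_function M A F \<longleftrightarrow>
     (\<forall>(p, v) \<in> tangent_bundle M A.
        0 \<le> F (p, v) \<and> (F (p, v) = 0 \<longleftrightarrow> v = (\<lambda>_. 0)) \<and>
        (\<forall>a :: complex. F (p, \<lambda>c. a *s v c) = cmod a * F (p, v))) \<and>
     (\<forall>c\<in>A.
        continuous_on (chart_image c \<times> UNIV) (in_chart A c F) \<and>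
        smooth_on (\<lambda>q. (in_chart A c F q)\<^sup>2) (chart_image c \<times> (UNIV - {0})) \<and>
        (\<forall>q \<in> chart_image c \<times> (UNIV - {0}). hermitian_pos_def (gmat (in_chart A c F) q)))"

text \<open>Order of the index arguments: as in the usual symbols, upper index first, then the lower
  ones from left to right; a bar on an index is not visible. So \<open>ginv F m i\<close> is the inverse
  matrix with indices \<open>m\<close>-bar, \<open>i\<close>, and \<open>curv F i j h k\<close> is \<open>R\<^sup>i\<close> with lower indices
  \<open>j\<close>, \<open>h\<close>-bar, \<open>k\<close>.\<close>

definition ginv :: "(point \<Rightarrow> real) \<Rightarrow> 2 \<Rightarrow> 2 \<Rightarrow> point \<Rightarrow> complex" where
  "ginv F m i p = matrix_inv (gmat F p) $ m $ i"

definition Nc :: "(point \<Rightarrow> real) \<Rightarrow> 2 \<Rightarrow> 2 \<Rightarrow> point \<Rightarrow> complex" where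
  "Nc F k j p = (\<Sum>m\<in>UNIV. \<Sum>l\<in>UNIV. ginv F m k p * dz j (gm F l m) p * snd p $ l)"

definition del :: "(point \<Rightarrow> real) \<Rightarrow> 2 \<Rightarrow> (point \<Rightarrow> complex) \<Rightarrow> point \<Rightarrow> complex" where
  "del F k f p = dz k f p - (\<Sum>j\<in>UNIV. Nc F j k p * deta j f p)"

definition delbar :: "(point \<Rightarrow> real) \<Rightarrow> 2 \<Rightarrow> (point \<Rightarrow> complex) \<Rightarrow> point \<Rightarrow> complex" where
  "delbar F k f p = dzbar k f p - (\<Sum>j\<in>UNIV. cnj (Nc F j k p) * detabar j f p)"

definition Lc :: "(point \<Rightarrow> real) \<Rightarrow> 2 \<Rightarrow> 2 \<Rightarrow> 2 \<Rightarrow> point \<Rightarrow> complex" where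
  "Lc F i j k p = (\<Sum>l\<in>UNIV. ginv F l i p * del F k (gm F j l) p)"

definition Cc :: "(point \<Rightarrow> real) \<Rightarrow> 2 \<Rightarrow> 2 \<Rightarrow> 2 \<Rightarrow> point \<Rightarrow> complex" where
  "Cc F i j k p = (\<Sum>l\<in>UNIV. ginv F l i p * deta k (gm F j l) p)"

definition curv :: "(point \<Rightarrow> real) \<Rightarrow> 2 \<Rightarrow> 2 \<Rightarrow> 2 \<Rightarrow> 2 \<Rightarrow> point \<Rightarrow> complex" where
  "curv F i j h k p = - delbar F h (Lc F i j k) p
     - (\<Sum>l\<in>UNIV. delbar F h (Nc F l k) p * Cc F i j l p)"

definition curv_low :: "(point \<Rightarrow> real) \<Rightarrow> 2 \<Rightarrow> 2 \<Rightarrow> 2 \<Rightarrow> 2 \<Rightarrow> point \<Rightarrow> complex" where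
  "curv_low F r j h k p = (\<Sum>i\<in>UNIV. gm F i r p * curv F i j h k p)"

definition l_up :: "(point \<Rightarrow> real) \<Rightarrow> 2 \<Rightarrow> point \<Rightarrow> complex" where
  "l_up F i p = snd p $ i / of_real (F p)"

definition l_low :: "(point \<Rightarrow> real) \<Rightarrow> 2 \<Rightarrow> point \<Rightarrow> complex" where
  "l_low F i p = (1 / of_real (F p)) * (\<Sum>j\<in>UNIV. gm F i j p * cnj (snd p $ j))"

text \<open>The determinant is a positive real number, for which the principal complex square root
  is the positive one.\<close>

definition sqrt_g :: "(point \<Rightarrow> real) \<Rightarrow> point \<Rightarrow> complex" where
  "sqrt_g F p = csqrt (det (gmat F p))"

definition m_up :: "(point \<Rightarrow> real) \<Rightarrow> 2 \<Rightarrow> point \<Rightarrow> complex" where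
  "m_up F i p = (if i = 1 then - l_low F 2 p / sqrt_g F p else l_low F 1 p / sqrt_g F p)"

definition m_low :: "(point \<Rightarrow> real) \<Rightarrow> 2 \<Rightarrow> point \<Rightarrow> complex" where
  "m_low F i p = (if i = 1 then - sqrt_g F p * l_up F 2 p else sqrt_g F p * l_up F 1 p)"

definition B_inv :: "(point \<Rightarrow> real) \<Rightarrow> point \<Rightarrow> complex" where
  "B_inv F p = (\<Sum>h\<in>UNIV. \<Sum>k\<in>UNIV. \<Sum>j\<in>UNIV.
     m_low F h p * m_up F k p * m_up F j p * Cc F h j k p)"

definition J_inv :: "(point \<Rightarrow> real) \<Rightarrow> point \<Rightarrow> complex" where
  "J_inv F p = (\<Sum>j\<in>UNIV. \<Sum>k\<in>UNIV. \<Sum>i\<in>UNIV.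
     l_up F j p * l_up F k p * l_low F i p * Lc F i j k p)"

definition V_inv :: "(point \<Rightarrow> real) \<Rightarrow> point \<Rightarrow> complex" where
  "V_inv F p = (\<Sum>j\<in>UNIV. \<Sum>k\<in>UNIV. \<Sum>i\<in>UNIV.
     l_up F j p * m_up F k p * l_low F i p * Lc F i j k p)"

definition E_inv :: "(point \<Rightarrow> real) \<Rightarrow> point \<Rightarrow> complex" where
  "E_inv F p = (\<Sum>j\<in>UNIV. \<Sum>k\<in>UNIV. \<Sum>i\<in>UNIV.
     l_up F j p * m_up F k p * m_low F i p * Lc F i j k p)"

definition H_inv :: "(point \<Rightarrow> real) \<Rightarrow> point \<Rightarrow> complex" where
  "H_inv F p = (\<Sum>j\<in>UNIV. \<Sum>k\<in>UNIV. \<Sum>i\<in>UNIV.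
     m_up F j p * m_up F k p * m_low F i p * Lc F i j k p)"

text \<open>The derivatives \<open>f\<close> with index \<open>|0\<close>-bar, and \<open>f\<close> with index \<open>|s\<close>-bar contracted with the
  conjugate of \<open>m\<^sup>s\<close>.\<close>

definition del0bar :: "(point \<Rightarrow> real) \<Rightarrow> (point \<Rightarrow> complex) \<Rightarrow> point \<Rightarrow> complex" where
  "del0bar F f p = (\<Sum>k\<in>UNIV. cnj (snd p $ k) * delbar F k f p)"

definition delmbar :: "(point \<Rightarrow> real) \<Rightarrow> (point \<Rightarrow> complex) \<Rightarrow> point \<Rightarrow> complex" where
  "delmbar F f p = (\<Sum>s\<in>UNIV. cnj (m_up F s p) * delbar F s f p)"

definition K_lambda :: "(point \<Rightarrow> real) \<Rightarrow> point \<Rightarrow> complex" where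
  "K_lambda F p = 2 * (\<Sum>r\<in>UNIV. \<Sum>j\<in>UNIV. \<Sum>h\<in>UNIV. \<Sum>k\<in>UNIV.
     curv_low F r j h k p * cnj (l_up F r p) * l_up F j p * cnj (l_up F h p) * l_up F k p)"

definition K_mu :: "(point \<Rightarrow> real) \<Rightarrow> point \<Rightarrow> complex" where
  "K_mu F p = 2 * (\<Sum>r\<in>UNIV. \<Sum>j\<in>UNIV. \<Sum>h\<in>UNIV. \<Sum>k\<in>UNIV.
     curv_low F r j h k p * cnj (m_up F r p) * m_up F j p * cnj (m_up F h p) * m_up F k p)"

definition bold_K :: "(point \<Rightarrow> real) \<Rightarrow> point \<Rightarrow> complex" where
  "bold_K F p = - (1 / of_real (F p)) * del0bar F (J_inv F) p"

definition bold_W :: "(point \<Rightarrow> real) \<Rightarrow> point \<Rightarrow> complex" where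
  "bold_W F p = - delmbar F (H_inv F) p
     - 1 / 2 * H_inv F p * (cnj (V_inv F p) + cnj (H_inv F p))
     - B_inv F p * of_real (F p) * delmbar F (E_inv F) p"

end

theory Submission
  imports Defs
begin

text \<open>The Chern--Finsler connection is metrical: the derivative \<open>\<delta>\<^sub>h\<close>-bar annihilates
  \<open>F\<close>, \<open>l\<^sup>i\<close> and \<open>l\<^sub>i\<close>, while it multiplies \<open>m\<^sup>i\<close> and \<open>m\<^sub>i\<close> by \<open>-a\<^sub>h\<close> and \<open>a\<^sub>h\<close>, where
  \<open>a\<^sub>h\<close> is half the conjugate of the trace \<open>L\<^sup>s\<^sub>s\<^sub>h\<close> and comes from differentiating
  \<open>\<surd>g\<close>. Hence the part of the curvature that comes from \<open>\<delta>\<^sub>h\<close>-bar of \<open>L\<^sup>i\<^sub>j\<^sub>k\<close> can be contracted with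
  the frame before differentiating, which yields the derivatives of \<open>J\<close> and \<open>H\<close>; the correction
  \<open>-a\<^sub>h H\<close> in the latter becomes the term with \<open>V\<close> and \<open>H\<close>. The torsion part vanishes along
  \<open>l\<close> since \<open>C\<^sup>i\<^sub>j\<^sub>k \<eta>\<^sup>j = C\<^sup>i\<^sub>j\<^sub>k \<eta>\<^sup>k = 0\<close> by Euler's theorem, and along \<open>m\<close> only the component
  \<open>B\<close> of \<open>C\<close> survives; it is paired with the derivative of \<open>N\<^sup>l\<^sub>k m\<^sub>l m\<^sup>k = F E\<close>.\<close>

subsection \<open>Wirtinger derivatives as derivations\<close>

text \<open>Complex linear functionals of the real Frechet derivative: the Leibniz rule and locality are
  then automatic. Differentiation in a conjugate direction is included.\<close>

definition derivation_at :: "'a::real_normed_vector \<Rightarrow> (('a \<Rightarrow> complex) \<Rightarrow> complex) \<Rightarrow> bool" where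
  "derivation_at p X \<longleftrightarrow> (\<exists>\<Phi>. (\<forall>f. X f = \<Phi> (frechet_derivative f (at p))) \<and>
     (\<forall>A B a b. \<Phi> (\<lambda>v. a * A v + b * B v) = a * \<Phi> A + b * \<Phi> B))"

text \<open>The sum, product and constant rules all reduce to this: at the fixed point the
  derivative of a product is a linear combination of derivatives whose coefficients are values at
  \<open>p\<close>.\<close>

lemma derivation_lincomb:
  assumes X: "derivation_at p X" and f: "f differentiable at p" and g: "g differentiable at p"
    and h: "\<And>v. frechet_derivative h (at p) v
      = a * frechet_derivative f (at p) v + b * frechet_derivative g (at p) v"
  shows "X h = a * X f + b * X g"
proof -
  from X obtain \<Phi> where \<Phi>: "\<And>f. X f = \<Phi> (frechet_derivative f (at p))"
      "\<And>A B a b. \<Phi> (\<lambda>v. a * A v + b * B v) = a * \<Phi> A + b * \<Phi> B"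
    unfolding derivation_at_def by blast
  have "frechet_derivative h (at p)
      = (\<lambda>v. a * frechet_derivative f (at p) v + b * frechet_derivative g (at p) v)"
    using h by blast
  then show ?thesis by (simp only: \<Phi>)
qed

lemma derivation_add:
  assumes X: "derivation_at p X" and f: "f differentiable at p" and g: "g differentiable at p"
  shows "X (\<lambda>q. f q + g q) = X f + X g"
proof -
  have "((\<lambda>q. f q + g q) has_derivative
      (\<lambda>v. frechet_derivative f (at p) v + frechet_derivative g (at p) v)) (at p)"
    using f g by (auto intro!: has_derivative_add simp: frechet_derivative_works)
  then have "frechet_derivative (\<lambda>q. f q + g q) (at p) v
      = 1 * frechet_derivative f (at p) v + 1 * frechet_derivative g (at p) v" for v
    by (simp add: frechet_derivative_at[symmetric])
  from derivation_lincomb[OF X f g this] show ?thesis by simp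
qed

lemma derivation_mult:
  assumes X: "derivation_at p X" and f: "f differentiable at p" and g: "g differentiable at p"
  shows "X (\<lambda>q. f q * g q) = X f * g p + f p * X g"
proof -
  have "((\<lambda>q. f q * g q) has_derivative
      (\<lambda>v. f p * frechet_derivative g (at p) v + frechet_derivative f (at p) v * g p)) (at p)"
    using f g by (auto intro!: has_derivative_mult simp: frechet_derivative_works)
  then have "frechet_derivative (\<lambda>q. f q * g q) (at p) v
      = g p * frechet_derivative f (at p) v + f p * frechet_derivative g (at p) v" for v
    by (simp add: frechet_derivative_at[symmetric])
  from derivation_lincomb[OF X f g this] show ?thesis by simp
qed

lemma derivation_const: "derivation_at p X \<Longrightarrow> X (\<lambda>q. a) = 0"
  using derivation_lincomb[of p X "\<lambda>q. a" "\<lambda>q. a" "\<lambda>q. a" 0 0] by simp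

lemma derivation_cmult:
  "derivation_at p X \<Longrightarrow> f differentiable at p \<Longrightarrow> X (\<lambda>q. a * f q) = a * X f"
  using derivation_mult[of p X "\<lambda>q. a" f] by (simp add: derivation_const)

lemma derivation_minus:
  "derivation_at p X \<Longrightarrow> f differentiable at p \<Longrightarrow> X (\<lambda>q. - f q) = - X f"
  using derivation_cmult[of p X f "-1"] by simp

lemma derivation_diff:
  "derivation_at p X \<Longrightarrow> f differentiable at p \<Longrightarrow> g differentiable at p
    \<Longrightarrow> X (\<lambda>q. f q - g q) = X f - X g"
  using derivation_add[of p X f "\<lambda>q. - g q"] by (simp add: derivation_minus)

text \<open>\<open>frechet_derivative\<close> chooses some derivative. Functions that agree near
  \<open>p\<close> have the same derivatives there, so the choice is the same, even where there is
  no derivative.\<close>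

lemma frechet_derivative_cong_open:
  assumes "open S" "p \<in> S" "\<And>q. q \<in> S \<Longrightarrow> f q = g q"
  shows "frechet_derivative f (at p) = frechet_derivative g (at p)"
proof -
  have "(f has_derivative D) (at p) \<longleftrightarrow> (g has_derivative D) (at p)" for D
    using assms has_derivative_transform_within_open[of f D p UNIV S g]
      has_derivative_transform_within_open[of g D p UNIV S f] by auto
  then show ?thesis unfolding frechet_derivative_def by presburger
qed

lemma differentiable_cong_open:
  assumes "open S" "p \<in> S" "\<And>q. q \<in> S \<Longrightarrow> f q = g q" "f differentiable at p"
  shows "g differentiable at p"
  using assms has_derivative_transform_within_open[of f _ p UNIV S g]
  unfolding differentiable_def by blast

lemma derivation_cong_open:
  assumes "derivation_at p X" "open S" "p \<in> S" "\<And>q. q \<in> S \<Longrightarrow> f q = g q"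
  shows "X f = X g"
  using assms(1) frechet_derivative_cong_open[OF assms(2-4)]
  unfolding derivation_at_def by auto

text \<open>Constant coefficients suffice for \<open>delbar\<close>: its coefficients, the
  conjugates of \<open>Nc\<close>, enter only through their values at \<open>p\<close>.\<close>

lemma derivation_comb:
  assumes "derivation_at p X" "derivation_at p Y"
  shows "derivation_at p (\<lambda>f. a * X f + b * Y f)"
proof -
  from assms(1) obtain P where
    P: "\<And>f. X f = P (frechet_derivative f (at p))"
      "\<And>A B c d. P (\<lambda>v. c * A v + d * B v) = c * P A + d * P B"
    unfolding derivation_at_def by blast
  from assms(2) obtain Q where
    Q: "\<And>f. Y f = Q (frechet_derivative f (at p))"
      "\<And>A B c d. Q (\<lambda>v. c * A v + d * B v) = c * Q A + d * Q B"
    unfolding derivation_at_def by blast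
  show ?thesis unfolding derivation_at_def
    by (rule exI[of _ "\<lambda>A. a * P A + b * Q A"]) (simp add: P Q algebra_simps)
qed

lemma derivation_direction: "derivation_at p (\<lambda>f. frechet_derivative f (at p) v)"
  unfolding derivation_at_def by (rule exI[of _ "\<lambda>A. A v"]) simp

lemma derivation_wirtinger:
  "derivation_at p (\<lambda>f. dz k f p)" "derivation_at p (\<lambda>f. dzbar k f p)"
  "derivation_at p (\<lambda>f. deta k f p)" "derivation_at p (\<lambda>f. detabar k f p)"
proof -
  have *: "derivation_at p (\<lambda>f. (frechet_derivative f (at p) v + c * frechet_derivative f (at p) w) / 2)"
    for c v w
    using derivation_comb[of p _ _ "1/2" "c/2", OF derivation_direction[of p v] derivation_direction[of p w]]
    by (simp add: field_simps)
  show "derivation_at p (\<lambda>f. dz k f p)" "derivation_at p (\<lambda>f. dzbar k f p)"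
  "derivation_at p (\<lambda>f. deta k f p)" "derivation_at p (\<lambda>f. detabar k f p)"
    unfolding dz_def dzbar_def deta_def detabar_def
    using *[of _ "-\<i>"] *[of _ "\<i>"] by simp_all
qed

lemma derivation_delbar: "derivation_at p (\<lambda>f. delbar F k f p)"
  using derivation_comb[where a=1 and b="-1", OF derivation_wirtinger(2)[of p k]
     derivation_comb[OF derivation_wirtinger(4)[of p 1] derivation_wirtinger(4)[of p 2],
       of "cnj (Nc F 1 k p)" "cnj (Nc F 2 k p)"]]
  unfolding delbar_def sum_2 by (simp add: algebra_simps)

section \<open>Conjugation and the fibre coordinates\<close>

lemma frechet_derivative_bounded_linear_comp:
  assumes "bounded_linear T" "f differentiable at p"
  shows "frechet_derivative (\<lambda>q. T (f q)) (at p) = (\<lambda>v. T (frechet_derivative f (at p) v))"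
  using assms bounded_linear.has_derivative[of T f "frechet_derivative f (at p)" "at p"]
  by (metis frechet_derivative_at frechet_derivative_works)

lemma wirtinger_cnj:
  assumes "f differentiable at p"
  shows "dz k (\<lambda>q. cnj (f q)) p = cnj (dzbar k f p)" "dzbar k (\<lambda>q. cnj (f q)) p = cnj (dz k f p)"
    "deta k (\<lambda>q. cnj (f q)) p = cnj (detabar k f p)" "detabar k (\<lambda>q. cnj (f q)) p = cnj (deta k f p)"
  unfolding dz_def dzbar_def deta_def detabar_def
    frechet_derivative_bounded_linear_comp[OF bounded_linear_cnj assms] by simp_all

text \<open>The connection is built with \<open>del\<close>, while the curvature differentiates with
  \<open>delbar\<close>; this passes from one to the other.\<close>

lemma delbar_cnj:
  assumes "f differentiable at p"
  shows "delbar F k (\<lambda>q. cnj (f q)) p = cnj (del F k f p)"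
  unfolding delbar_def del_def by (simp add: wirtinger_cnj[OF assms])

lemma wirtinger_snd:
  "dz k (\<lambda>q. snd q $ i) p = 0" "dzbar k (\<lambda>q. snd q $ i) p = 0"
  "deta k (\<lambda>q. snd q $ i) p = (if i = k then 1 else 0)" "detabar k (\<lambda>q. snd q $ i) p = 0"
proof -
  have "bounded_linear (\<lambda>q::point. snd q $ i)"
    by (intro bounded_linear_compose[OF bounded_linear_vec_nth bounded_linear_snd])
  then have *: "frechet_derivative (\<lambda>q::point. snd q $ i) (at p) = (\<lambda>q. snd q $ i)"
    by (metis bounded_linear_imp_has_derivative frechet_derivative_at)
  show "dz k (\<lambda>q. snd q $ i) p = 0" "dzbar k (\<lambda>q. snd q $ i) p = 0"
    "deta k (\<lambda>q. snd q $ i) p = (if i = k then 1 else 0)" "detabar k (\<lambda>q. snd q $ i) p = 0"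
    unfolding dz_def dzbar_def deta_def detabar_def * by (auto simp: axis_def)
qed

lemma differentiable_snd_nth: "(\<lambda>q::point. snd q $ i) differentiable at p"
  by (intro bounded_linear_imp_differentiable bounded_linear_compose[OF bounded_linear_vec_nth bounded_linear_snd])

lemma del_snd: "del F k (\<lambda>q. snd q $ i) p = - Nc F i k p" "delbar F k (\<lambda>q. snd q $ i) p = 0"
proof -
  have "(\<Sum>j\<in>UNIV. Nc F j k p * (if i = j then 1 else 0)) = Nc F i k p"
    by (simp add: sum.delta' if_distrib cong: if_cong)
  then show "del F k (\<lambda>q. snd q $ i) p = - Nc F i k p" "delbar F k (\<lambda>q. snd q $ i) p = 0"
    unfolding del_def delbar_def by (simp_all add: wirtinger_snd)
qed

lemma derivation_sum:
  assumes D: "derivation_at p X" and f: "\<And>i. i \<in> I \<Longrightarrow> f i differentiable at p"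
  shows "X (\<lambda>q. \<Sum>i\<in>I. f i q) = (\<Sum>i\<in>I. X (f i))"
  using f
proof (induction I rule: infinite_finite_induct)
  case (insert i I)
  have "(\<lambda>q. \<Sum>i\<in>I. f i q) differentiable at p"
    using insert by (intro differentiable_sum) auto
  then show ?case using insert by (simp add: derivation_add[OF D])
qed (simp_all add: derivation_const[OF D])

lemma differentiable_cnj: "f differentiable at p \<Longrightarrow> (\<lambda>q. cnj (f q)) differentiable at p"
  unfolding differentiable_def by (blast intro: has_derivative_cnj)

subsection \<open>Smooth functions\<close>

text \<open>The rules for derivatives give equations only at points of \<open>S\<close>; openness of
  \<open>S\<close> lets such an equation be differentiated again.\<close>

lemma Ck_on_cong:
  assumes "open S" "\<And>q. q \<in> S \<Longrightarrow> f q = g q" "Ck_on k f S"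
  shows "Ck_on k g S"
  using assms(2-)
proof (induction k arbitrary: f g)
  case 0
  then show ?case by (simp cong: continuous_on_cong)
next
  case (Suc k)
  show ?case unfolding Ck_on.simps
  proof (intro conjI ballI allI)
    fix x assume "x \<in> S"
    then show "g differentiable at x"
      using Suc.prems differentiable_cong_open[OF assms(1), of x f g] by auto
  next
    fix v
    have "\<And>q. q \<in> S \<Longrightarrow> frechet_derivative f (at q) v = frechet_derivative g (at q) v"
      using Suc.prems(1) frechet_derivative_cong_open[OF assms(1), of _ f g] by metis
    moreover have "Ck_on k (\<lambda>x. frechet_derivative f (at x) v) S"
      using Suc.prems(2) by simp
    ultimately show "Ck_on k (\<lambda>x. frechet_derivative g (at x) v) S"
      by (rule Suc.IH)
  qed
qed

lemma Ck_on_linear: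
  assumes "open S" "bounded_linear T" "Ck_on k f S"
  shows "Ck_on k (\<lambda>q. T (f q)) S"
  using assms(3)
proof (induction k arbitrary: f)
  case 0
  then show ?case using assms(2) by (simp add: bounded_linear.continuous_on)
next
  case (Suc k)
  show ?case unfolding Ck_on.simps
  proof (intro conjI ballI allI)
    fix x assume "x \<in> S"
    then show "(\<lambda>q. T (f q)) differentiable at x"
      using Suc.prems bounded_linear.has_derivative[OF assms(2)] unfolding Ck_on.simps differentiable_def by blast
  next
    fix v
    have "Ck_on k (\<lambda>x. T (frechet_derivative f (at x) v)) S"
      using Suc by auto
    then show "Ck_on k (\<lambda>x. frechet_derivative (\<lambda>q. T (f q)) (at x) v) S"
      by (rule Ck_on_cong[OF assms(1), rotated])
         (use Suc.prems frechet_derivative_bounded_linear_comp[OF assms(2), of f] in \<open>auto simp: fun_eq_iff\<close>)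
  qed
qed

lemma Ck_on_add:
  assumes "open S" "Ck_on k f S" "Ck_on k g S"
  shows "Ck_on k (\<lambda>q. f q + g q) S"
  using assms(2-)
proof (induction k arbitrary: f g)
  case 0
  then show ?case by (simp add: continuous_on_add)
next
  case (Suc k)
  show ?case unfolding Ck_on.simps
  proof (intro conjI ballI allI)
    fix x assume "x \<in> S"
    then show "(\<lambda>q. f q + g q) differentiable at x"
      using Suc.prems by auto
  next
    fix v
    have eq: "frechet_derivative f (at q) v + frechet_derivative g (at q) v
        = frechet_derivative (\<lambda>q. f q + g q) (at q) v" if "q \<in> S" for q
    proof -
      have "((\<lambda>q. f q + g q) has_derivative
        (\<lambda>v. frechet_derivative f (at q) v + frechet_derivative g (at q) v)) (at q)"
        using Suc.prems that by (auto intro!: has_derivative_add simp: frechet_derivative_works)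
      then show ?thesis by (simp add: frechet_derivative_at[symmetric])
    qed
    have "Ck_on k (\<lambda>x. frechet_derivative f (at x) v + frechet_derivative g (at x) v) S"
      using Suc by auto
    then show "Ck_on k (\<lambda>x. frechet_derivative (\<lambda>q. f q + g q) (at x) v) S"
      by (rule Ck_on_cong[OF assms(1), rotated]) (rule eq)
  qed
qed

lemma smooth_on_frechet_derivative: "smooth_on f S \<Longrightarrow> smooth_on (\<lambda>x. frechet_derivative f (at x) v) S"
  unfolding smooth_on_def by (metis Ck_on.simps(2))

lemma smooth_on_differentiable: "smooth_on f S \<Longrightarrow> x \<in> S \<Longrightarrow> f differentiable at x"
  unfolding smooth_on_def by (metis Ck_on.simps(2))

text \<open>A Wirtinger derivative is a combination of two directional derivatives with constant
  coefficients, so closure of \<open>Ck_on\<close> under sums and bounded linear maps is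
  enough.\<close>

lemma smooth_on_wirtinger:
  assumes "open S" "smooth_on f S"
  shows "smooth_on (dz k f) S" "smooth_on (deta k f) S" "smooth_on (detabar k f) S"
proof -
  have "smooth_on (\<lambda>x. (1/2) * frechet_derivative f (at x) v + c * frechet_derivative f (at x) w) S"
    for v w and c :: complex
    unfolding smooth_on_def
  proof
    fix k
    have "Ck_on k (\<lambda>x. frechet_derivative f (at x) v) S" "Ck_on k (\<lambda>x. frechet_derivative f (at x) w) S"
      using smooth_on_frechet_derivative[OF assms(2)] by (simp_all only: smooth_on_def)
    then show "Ck_on k (\<lambda>x. (1/2) * frechet_derivative f (at x) v + c * frechet_derivative f (at x) w) S"
      by (intro Ck_on_add Ck_on_linear[OF \<open>open S\<close> bounded_linear_mult_right] assms(1))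
  qed
  note * = this
  have eq: "(a + c * b) / 2 = (1/2) * a + (c/2) * b" "(a - c * b) / 2 = (1/2) * a + (-c/2) * b"
    for a b c :: complex
    by (simp_all add: field_simps)
  show "smooth_on (dz k f) S" "smooth_on (deta k f) S" "smooth_on (detabar k f) S"
    unfolding dz_def[abs_def] deta_def[abs_def] detabar_def[abs_def] eq by (rule *)+
qed

subsection \<open>Homogeneity\<close>

lemma i_i_mult: "\<i> * (\<i> * x) = - x"
  by (simp flip: mult.assoc)

lemma bounded_linear_scale_fibre: "bounded_linear (\<lambda>q::point. (fst q, t *s snd q))"
proof -
  have "linear (\<lambda>q::point. (fst q, t *s snd q))"
    by (rule linearI) (auto simp: vec_eq_iff algebra_simps)
  then show ?thesis by (simp add: linear_conv_bounded_linear)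
qed

lemma bounded_linear_complex_line: "bounded_linear (\<lambda>t. t *s (\<eta> :: complex^2))"
proof -
  have "linear (\<lambda>t. t *s (\<eta> :: complex^2))"
    by (rule linearI) (auto simp: vec_eq_iff algebra_simps)
  then show ?thesis by (simp add: linear_conv_bounded_linear)
qed

lemma fibre_vector_decomp:
  "(0, w) = (\<Sum>j\<in>UNIV. Re (w $ j) *\<^sub>R (0, axis j 1) + Im (w $ j) *\<^sub>R ((0::complex^2), axis j \<i>))"
  for w :: "complex^2"
proof (rule prod_eqI)
  have "w = (\<Sum>j\<in>UNIV. Re (w $ j) *\<^sub>R axis j 1 + Im (w $ j) *\<^sub>R axis j \<i>)"
    by (simp add: sum_2 vec_eq_iff forall_2 axis_def complex_eq_iff)
  then show "snd (0::complex^2, w)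
      = snd (\<Sum>j\<in>UNIV. Re (w $ j) *\<^sub>R (0, axis j 1) + Im (w $ j) *\<^sub>R ((0::complex^2), axis j \<i>))"
    by (simp add: sum_2)
qed (simp add: sum_2)

text \<open>The real derivative splits into a complex linear and an antilinear part, whose
  coefficients are the Wirtinger derivatives.\<close>

lemma frechet_derivative_fibre:
  assumes "f differentiable at p"
  shows "frechet_derivative f (at p) (0, w)
    = (\<Sum>j\<in>UNIV. w $ j * deta j f p + cnj (w $ j) * detabar j f p)"
proof -
  interpret D: bounded_linear "frechet_derivative f (at p)"
    using assms by (metis frechet_derivative_works has_derivative_bounded_linear)
  have *: "Re c *\<^sub>R a + Im c *\<^sub>R b = c * ((a - \<i> * b) / 2) + cnj c * ((a + \<i> * b) / 2)" for c a b
    by (simp add: complex_eq_iff algebra_simps add_divide_distrib diff_divide_distrib)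
  show ?thesis
    by (subst fibre_vector_decomp) (simp only: D.sum D.add D.scaleR deta_def detabar_def *)
qed

text \<open>Differentiate in the complex parameter t at t = 1. The factors on the right are the
  Wirtinger derivatives of \<open>u\<close> in t and in its conjugate. The cases applied below are u
  = t * cnj t, t and 1.\<close>

lemma euler_identities:
  assumes f: "f differentiable at (z, \<eta>)"
    and hom: "\<And>t. t \<noteq> 0 \<Longrightarrow> f (z, t *s \<eta>) = u t * f (z, \<eta>)"
    and u: "(u has_derivative D) (at 1)"
  shows "(\<Sum>j\<in>UNIV. \<eta> $ j * deta j f (z, \<eta>)) = (D 1 - \<i> * D \<i>) / 2 * f (z, \<eta>)"
    and "(\<Sum>j\<in>UNIV. cnj (\<eta> $ j) * detabar j f (z, \<eta>)) = (D 1 + \<i> * D \<i>) / 2 * f (z, \<eta>)"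
proof -
  let ?f' = "frechet_derivative f (at (z, \<eta>))" and ?c = "f (z, \<eta>)"
  have "((\<lambda>t. (z, t *s \<eta>)) has_derivative (\<lambda>v. (0, v *s \<eta>))) (at 1)"
    by (intro has_derivative_Pair has_derivative_const bounded_linear_imp_has_derivative
        bounded_linear_complex_line)
  moreover have "(f has_derivative ?f') (at (z, 1 *s \<eta>))"
    using f by (simp add: frechet_derivative_works)
  ultimately have "((\<lambda>t. f (z, t *s \<eta>)) has_derivative (\<lambda>v. ?f' (0, v *s \<eta>))) (at 1)"
    by (rule has_derivative_compose)
  \<comment> \<open>Homogeneity is available for nonzero t; the complement of 0 is an open
    neighbourhood of 1.\<close>
  then have "((\<lambda>t. u t * ?c) has_derivative (\<lambda>v. ?f' (0, v *s \<eta>))) (at 1)"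
    by (rule has_derivative_transform_within_open[of _ _ _ _ "- {0}"]) (auto simp: hom)
  moreover have "((\<lambda>t. u t * ?c) has_derivative (\<lambda>v. D v * ?c)) (at 1)"
    by (rule has_derivative_mult_left[OF u])
  ultimately have "(\<lambda>v. ?f' (0, v *s \<eta>)) = (\<lambda>v. D v * ?c)"
    by (rule has_derivative_unique)
  then have *: "?f' (0, v *s \<eta>) = D v * ?c" for v
    by (rule fun_cong)
  \<comment> \<open>The derivative in direction v is v * a + cnj v * b; the directions 1 and i
    separate the two sums.\<close>
  define a b where "a = (\<Sum>j\<in>UNIV. \<eta> $ j * deta j f (z, \<eta>))"
    and "b = (\<Sum>j\<in>UNIV. cnj (\<eta> $ j) * detabar j f (z, \<eta>))"
  have "v * a + cnj v * b = D v * ?c" for v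
    unfolding *[symmetric] frechet_derivative_fibre[OF f] a_def b_def
    by (simp add: sum_2 algebra_simps)
  from this[of 1] this[of \<i>] have ab: "a + b = D 1 * ?c" "\<i> * a - \<i> * b = D \<i> * ?c"
    by simp_all
  have "(D 1 - \<i> * D \<i>) * ?c = D 1 * ?c - \<i> * (D \<i> * ?c)"
    "(D 1 + \<i> * D \<i>) * ?c = D 1 * ?c + \<i> * (D \<i> * ?c)"
    by (simp_all add: algebra_simps)
  then have "(D 1 - \<i> * D \<i>) * ?c = 2 * a" "(D 1 + \<i> * D \<i>) * ?c = 2 * b"
    unfolding ab[symmetric] by (simp_all add: algebra_simps i_i_mult)
  then show "a = (D 1 - \<i> * D \<i>) / 2 * ?c" "b = (D 1 + \<i> * D \<i>) / 2 * ?c"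
    by simp_all
qed

text \<open>Chain rule for the dilation of the fibre by t: the derivative in \<eta> collects t, that
  in the conjugate of \<eta> collects cnj t. In this way homogeneity descends from \<open>L\<close>
  through \<open>detabar j L\<close> to \<open>gm\<close>.\<close>

lemma wirtinger_scale:
  assumes S: "open S" "(z, \<eta>) \<in> S"
    and f: "f differentiable at (z, \<eta>)" "f differentiable at (z, t *s \<eta>)"
    and hom: "\<And>q. q \<in> S \<Longrightarrow> f (fst q, t *s snd q) = u * f q"
  shows "t * deta k f (z, t *s \<eta>) = u * deta k f (z, \<eta>)"
    and "cnj t * detabar k f (z, t *s \<eta>) = u * detabar k f (z, \<eta>)"
proof -
  let ?g = "frechet_derivative f (at (z, t *s \<eta>))" and ?f = "frechet_derivative f (at (z, \<eta>))"
  let ?a = "deta k f (z, t *s \<eta>)" and ?b = "detabar k f (z, t *s \<eta>)"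
  have "((\<lambda>q. (fst q, t *s snd q)) has_derivative (\<lambda>v. (fst v, t *s snd v))) (at (z, \<eta>))"
    by (intro bounded_linear_imp_has_derivative bounded_linear_scale_fibre)
  moreover have "(f has_derivative ?g) (at (fst (z, \<eta>), t *s snd (z, \<eta>)))"
    using f by (simp add: frechet_derivative_works)
  ultimately have "((\<lambda>q. f (fst q, t *s snd q)) has_derivative (\<lambda>v. ?g (fst v, t *s snd v))) (at (z, \<eta>))"
    by (rule has_derivative_compose)
  then have "((\<lambda>q. u * f q) has_derivative (\<lambda>v. ?g (fst v, t *s snd v))) (at (z, \<eta>))"
    by (rule has_derivative_transform_within_open[OF _ S]) (auto simp: hom)
  moreover have "((\<lambda>q. u * f q) has_derivative (\<lambda>v. u * ?f v)) (at (z, \<eta>))"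
    using f by (intro has_derivative_mult_right) (simp add: frechet_derivative_works)
  ultimately have "(\<lambda>v. ?g (fst v, t *s snd v)) = (\<lambda>v. u * ?f v)"
    by (rule has_derivative_unique)
  from fun_cong[OF this, of "(0, axis k _)"] have "u * ?f (0, axis k w) = ?g (0, t *s axis k w)" for w
    by simp
  then have "u * ?f (0, axis k w) = t * w * ?a + cnj (t * w) * ?b" for w
    using exhaust_2[of k] unfolding frechet_derivative_fibre[OF f(2)]
    by (auto simp: sum_2 axis_def)
  from this[of 1] this[of \<i>]
  have uf: "u * ?f (0, axis k 1) = t * ?a + cnj t * ?b"
    "u * ?f (0, axis k \<i>) = t * \<i> * ?a - cnj t * \<i> * ?b"
    by simp_all
  have "u * (?f (0, axis k 1) - \<i> * ?f (0, axis k \<i>)) = u * ?f (0, axis k 1) - \<i> * (u * ?f (0, axis k \<i>))"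
    "u * (?f (0, axis k 1) + \<i> * ?f (0, axis k \<i>)) = u * ?f (0, axis k 1) + \<i> * (u * ?f (0, axis k \<i>))"
    by (simp_all add: algebra_simps)
  then have "u * (?f (0, axis k 1) - \<i> * ?f (0, axis k \<i>)) = 2 * (t * ?a)"
    "u * (?f (0, axis k 1) + \<i> * ?f (0, axis k \<i>)) = 2 * (cnj t * ?b)"
    unfolding uf by (simp_all add: algebra_simps i_i_mult)
  then show "t * ?a = u * deta k f (z, \<eta>)" "cnj t * ?b = u * detabar k f (z, \<eta>)"
    by (simp_all add: deta_def[of k f "(z, \<eta>)"] detabar_def[of k f "(z, \<eta>)"])
qed

subsection \<open>Matrices of size two\<close>

lemma two_cases:
  assumes "(i::2) = 1 \<Longrightarrow> P" "i = 2 \<Longrightarrow> P" shows P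
  using exhaust_2[of i] assms by blast

text \<open>\<open>matrix_inv\<close> is a choice, but any two-sided inverse X satisfies X = (B G) X
  = B (G X) = B.\<close>

lemma matrix_inv_eqI:
  fixes G B :: "complex^2^2"
  assumes "B ** G = mat 1"
  shows "matrix_inv G = B"
proof -
  have BG: "B ** G = mat 1" "G ** B = mat 1"
    using assms matrix_left_right_inverse by blast+
  have "G ** matrix_inv G = mat 1 \<and> matrix_inv G ** G = mat 1"
    unfolding matrix_inv_def by (rule someI[of _ B]) (simp add: BG)
  then have "B ** (G ** matrix_inv G) = B" by simp
  then show ?thesis unfolding matrix_mul_assoc BG by simp
qed

text \<open>The adjugate over the determinant. It makes the entries of the inverse metric explicit,
  so that they can be differentiated.\<close>

lemma matrix_inv_2:
  fixes G :: "complex^2^2"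
  assumes "det G \<noteq> 0"
  shows "matrix_inv G = (\<chi> m i. (if m = i then G $ (if m = 1 then 2 else 1) $ (if m = 1 then 2 else 1)
     else - G $ m $ i) / det G)"
proof (rule matrix_inv_eqI)
  have "G $ 1 $ 1 * G $ 2 $ 2 - G $ 1 $ 2 * G $ 2 $ 1 = det G" by (simp add: det_2)
  with assms show "(\<chi> m i. (if m = i then G $ (if m = 1 then 2 else 1) $ (if m = 1 then 2 else 1)
     else - G $ m $ i) / det G) ** G = mat 1"
    by (simp add: vec_eq_iff forall_2 matrix_matrix_mult_def sum_2 mat_def mult.commute
        flip: add_divide_distrib diff_divide_distrib)
qed

lemma hermitian_pos_def_det:
  assumes "hermitian_pos_def G"
  shows "Im (det G) = 0" "Re (det G) > 0"
proof -
  have h: "G $ j $ i = cnj (G $ i $ j)" for i j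
    using assms unfolding hermitian_pos_def_def by blast
  have q: "0 < Re (\<Sum>i\<in>UNIV. \<Sum>j\<in>UNIV. G $ i $ j * \<xi> $ i * cnj (\<xi> $ j))" if "\<xi> \<noteq> 0" for \<xi> :: "complex^2"
    using assms that unfolding hermitian_pos_def_def by blast
  have im: "Im (G $ i $ i) = 0" for i
    using arg_cong[OF h[of i i], of Im] by simp
  show "Im (det G) = 0"
    unfolding det_2 h[of 2 1] by (simp add: im)
  have "axis 1 (1::complex) \<noteq> (0 :: complex^2)" by (simp add: axis_eq_0_iff)
  from q[OF this] have g1: "0 < Re (G $ 1 $ 1)" by (simp add: sum_2 axis_def)
  \<comment> \<open>Contracting G with this vector in the first index gives 0 in the first column
    and the determinant in the second, so the Hermitian form at it is the determinant times the
    conjugate of the first diagonal entry.\<close>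
  define \<xi> :: "complex^2" where "\<xi> = (\<chi> i. if i = 1 then - G $ 2 $ 1 else G $ 1 $ 1)"
  have \<xi>: "\<xi> $ 1 = - G $ 2 $ 1" "\<xi> $ 2 = G $ 1 $ 1" by (simp_all add: \<xi>_def)
  have "\<xi> $ 2 \<noteq> 0" using g1 \<xi>(2) by auto
  then have "\<xi> \<noteq> 0" by auto
  have "(\<Sum>i\<in>UNIV. \<Sum>j\<in>UNIV. G $ i $ j * \<xi> $ i * cnj (\<xi> $ j)) = cnj (G $ 1 $ 1) * det G"
    unfolding sum_2 \<xi> det_2 by (simp add: h[of 1 2, symmetric] h[of 2 1, symmetric] algebra_simps)
  with q[OF \<open>\<xi> \<noteq> 0\<close>] have "0 < Re (G $ 1 $ 1) * Re (det G)"
    using im by simp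
  then show "Re (det G) > 0" using g1 by (simp add: zero_less_mult_iff)
qed

subsection \<open>The metric and the connection in a chart\<close>

text \<open>What the computation needs to know about a chart expression of a Finsler function;
  \<open>local_finsler_in_chart\<close> supplies it from the axioms on the tangent bundle.\<close>

locale local_finsler =
  fixes F :: "point \<Rightarrow> real" and U :: "(complex^2) set"
  assumes open_U: "open U"
    and smooth: "smooth_on (\<lambda>q. (F q)\<^sup>2) (U \<times> (UNIV - {0}))"
    and hpd: "\<And>q. q \<in> U \<times> (UNIV - {0}) \<Longrightarrow> hermitian_pos_def (gmat F q)"
    and homogeneous: "\<And>z \<eta> t. z \<in> U \<Longrightarrow> F (z, t *s \<eta>) = cmod t * F (z, \<eta>)"
    and pos: "\<And>z \<eta>. z \<in> U \<Longrightarrow> \<eta> \<noteq> 0 \<Longrightarrow> F (z, \<eta>) > 0"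
begin

definition S :: "point set" where "S = U \<times> (UNIV - {0})"

text \<open>Complex valued although real, since the Wirtinger operators act on complex
  functions.\<close>

definition L :: "point \<Rightarrow> complex" where "L q = complex_of_real ((F q)\<^sup>2)"

lemma open_S: "open S"
  unfolding S_def by (intro open_Times open_U open_delete open_UNIV)

lemma scale_mem: "t \<noteq> 0 \<Longrightarrow> q \<in> S \<Longrightarrow> (fst q, t *s snd q) \<in> S"
  by (auto simp: S_def mem_Times_iff)

lemma smooth_L: "smooth_on L S"
  unfolding smooth_on_def L_def[abs_def]
proof
  fix k
  have "Ck_on k (\<lambda>q. (F q)\<^sup>2) S"
    using smooth by (simp only: smooth_on_def S_def)
  then show "Ck_on k (\<lambda>q. complex_of_real ((F q)\<^sup>2)) S"
    by (rule Ck_on_linear[OF open_S bounded_linear_of_real])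
qed

lemma gm_L: "gm F i j = deta i (detabar j L)"
  by (simp only: gm_def L_def[abs_def])

lemma smooth_gm: "smooth_on (gm F i j) S"
  unfolding gm_L by (intro smooth_on_wirtinger open_S smooth_L)

lemma L_differentiable: "p \<in> S \<Longrightarrow> L differentiable at p"
  by (rule smooth_on_differentiable[OF smooth_L])

lemma detabar_L_differentiable: "p \<in> S \<Longrightarrow> detabar j L differentiable at p"
  by (rule smooth_on_differentiable[OF smooth_on_wirtinger(3)[OF open_S smooth_L]])

text \<open>First derivatives of the metric are included because \<open>Nc\<close> and
  \<open>Lc\<close> contain them and are differentiated once more in the curvature.\<close>

lemma gm_differentiable:
  assumes "p \<in> S"
  shows "gm F i j differentiable at p"
    "dz k (gm F i j) differentiable at p" "deta k (gm F i j) differentiable at p"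
  using smooth_on_differentiable[OF _ assms] smooth_on_wirtinger(1,2)[OF open_S smooth_gm] smooth_gm
  by blast+

section \<open>Homogeneity of L and of the metric\<close>

lemma L_scale: "q \<in> S \<Longrightarrow> L (fst q, t *s snd q) = (t * cnj t) * L q"
  using homogeneous[of "fst q" t "snd q"]
  by (simp add: S_def mem_Times_iff L_def power_mult_distrib flip: complex_norm_square)

lemma detabar_L_scale:
  assumes t: "t \<noteq> 0" and q: "q \<in> S"
  shows "detabar j L (fst q, t *s snd q) = t * detabar j L q"
proof -
  have "cnj t * detabar j L (fst q, t *s snd q) = (t * cnj t) * detabar j L (fst q, snd q)"
    by (rule wirtinger_scale(2)[OF open_S])
       (simp_all only: prod.collapse q L_differentiable scale_mem[OF t q] L_scale)
  then show ?thesis using t by simp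
qed

lemma gm_scale:
  assumes t: "t \<noteq> 0" and q: "q \<in> S"
  shows "gm F i j (fst q, t *s snd q) = gm F i j q"
proof -
  have "t * gm F i j (fst q, t *s snd q) = t * gm F i j (fst q, snd q)"
    unfolding gm_L by (rule wirtinger_scale(1)[OF open_S])
       (simp_all only: prod.collapse q detabar_L_differentiable scale_mem[OF t q] detabar_L_scale[OF t])
  then show ?thesis using t by simp
qed

lemma gm_eta:
  assumes p: "p \<in> S" shows "(\<Sum>i\<in>UNIV. gm F i j p * snd p $ i) = detabar j L p"
proof -
  \<comment> \<open>The factor (1 - i * i) / 2 is 1, the derivative of u t = t, left in the form
    that \<open>euler_identities\<close> produces.\<close>
  have "(\<Sum>i\<in>UNIV. snd p $ i * deta i (detabar j L) (fst p, snd p)) = (1 - \<i> * \<i>) / 2 * detabar j L (fst p, snd p)"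
    using detabar_L_scale[OF _ p] detabar_L_differentiable[OF p]
    by (intro euler_identities(1)[where u = "\<lambda>t. t"]) simp_all
  then show ?thesis by (simp add: gm_L mult.commute)
qed

lemma L_eq:
  assumes p: "p \<in> S" shows "L p = (\<Sum>i\<in>UNIV. \<Sum>j\<in>UNIV. gm F i j p * snd p $ i * cnj (snd p $ j))"
proof -
  have "((\<lambda>t. t * cnj t) has_derivative (\<lambda>v. 1 * cnj v + v * cnj 1)) (at 1)"
    by (intro has_derivative_mult has_derivative_cnj has_derivative_ident)
  from euler_identities(2)[of L "fst p" "snd p", OF _ _ this]
  have "(\<Sum>j\<in>UNIV. cnj (snd p $ j) * detabar j L p) = L p"
    using L_scale[OF p] L_differentiable[OF p] by simp
  then show ?thesis
    by (simp add: gm_eta[OF p, symmetric] sum_2 algebra_simps)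
qed

lemma euler_gm:
  assumes p: "p \<in> S" shows "(\<Sum>k\<in>UNIV. deta k (gm F i j) p * snd p $ k) = 0"
proof -
  have "(\<Sum>k\<in>UNIV. snd p $ k * deta k (gm F i j) (fst p, snd p)) = (0 - \<i> * 0) / 2 * gm F i j (fst p, snd p)"
    using gm_scale[OF _ p] gm_differentiable(1)[OF p]
    by (intro euler_identities(1)[where u = "\<lambda>t. 1"]) simp_all
  then show ?thesis by (simp add: mult.commute)
qed

text \<open>Unlike in \<open>euler_gm\<close>, the sum runs over an index of the metric.
  Differentiating \<open>gm_eta\<close> in the k-th fibre coordinate gives \<open>gm F k j\<close>
  on both sides, on the left from the derivative of \<eta>, and these cancel.\<close>

lemma deta_gm_eta:
  assumes p: "p \<in> S" shows "(\<Sum>i\<in>UNIV. deta k (gm F i j) p * snd p $ i) = 0"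
proof -
  note D = derivation_wirtinger(3)[of p k]
  have "deta k (\<lambda>q. gm F 1 j q * snd q $ 1 + gm F 2 j q * snd q $ 2) p = deta k (detabar j L) p"
    using gm_eta by (intro derivation_cong_open[OF D open_S p]) (simp add: sum_2)
  also have "\<dots> = gm F k j p"
    by (simp only: gm_L)
  finally have "deta k (gm F 1 j) p * snd p $ 1 + gm F 1 j p * (if 1 = k then 1 else 0)
     + (deta k (gm F 2 j) p * snd p $ 2 + gm F 2 j p * (if 2 = k then 1 else 0)) = gm F k j p"
    by (simp only: derivation_add[OF D] derivation_mult[OF D] differentiable_mult
       gm_differentiable[OF p] differentiable_snd_nth wirtinger_snd)
  then show ?thesis using exhaust_2[of k] by (auto simp: sum_2)
qed

section \<open>Positivity, the inverse metric and differentiability\<close>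

lemma gm_hermitian: "p \<in> S \<Longrightarrow> cnj (gm F i j p) = gm F j i p"
proof -
  assume "p \<in> S"
  then have "gmat F p $ j $ i = cnj (gmat F p $ i $ j)"
    using hpd[of p] unfolding S_def hermitian_pos_def_def by blast
  then show ?thesis by (simp add: gmat_def)
qed

lemma det_gmat: "det (gmat F p) = gm F 1 1 p * gm F 2 2 p - gm F 1 2 p * gm F 2 1 p"
  by (simp add: det_2 gmat_def)

lemma det_pos: "p \<in> S \<Longrightarrow> Im (det (gmat F p)) = 0" "p \<in> S \<Longrightarrow> Re (det (gmat F p)) > 0"
  using hermitian_pos_def_det[OF hpd] by (simp_all only: S_def)

lemma det_nonzero: "p \<in> S \<Longrightarrow> det (gmat F p) \<noteq> 0"
  using det_pos(2)[of p] by auto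

lemma sqrt_g_square: "sqrt_g F p * sqrt_g F p = det (gmat F p)"
  unfolding sqrt_g_def by (metis power2_csqrt power2_eq_square)

lemma sqrt_g_real: "p \<in> S \<Longrightarrow> cnj (sqrt_g F p) = sqrt_g F p"
  using det_pos[of p] by (simp add: sqrt_g_def complex_eq_iff)

lemma ginv_eq:
  assumes p: "p \<in> S"
  shows "ginv F 1 1 p = gm F 2 2 p / det (gmat F p)" "ginv F 1 2 p = - gm F 1 2 p / det (gmat F p)"
    "ginv F 2 1 p = - gm F 2 1 p / det (gmat F p)" "ginv F 2 2 p = gm F 1 1 p / det (gmat F p)"
  unfolding ginv_def matrix_inv_2[OF det_nonzero[OF p]] by (simp_all add: gmat_def)

lemma ginv_gm:
  assumes p: "p \<in> S"
  shows "(\<Sum>i\<in>UNIV. gm F i r p * ginv F m i p) = (if r = m then 1 else 0)"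
proof -
  have "gm F 1 1 p * gm F 2 2 p - gm F 1 2 p * gm F 2 1 p \<noteq> 0"
    using det_nonzero[OF p] by (simp only: det_gmat not_False_eq_True)
  then show ?thesis
    using exhaust_2[of r] exhaust_2[of m]
    by (auto simp: sum_2 ginv_eq[OF p] det_gmat mult.commute simp flip: add_divide_distrib diff_divide_distrib)
qed

abbreviation Fc :: "point \<Rightarrow> complex" where "Fc q \<equiv> complex_of_real (F q)"

lemma F_pos: "p \<in> S \<Longrightarrow> F p > 0"
  using pos[of "fst p" "snd p"] by (simp add: S_def mem_Times_iff)

lemma Fc_nonzero: "p \<in> S \<Longrightarrow> Fc p \<noteq> 0"
  using F_pos[of p] by simp

lemma Fc_square: "Fc p * Fc p = L p"
  by (simp add: L_def power2_eq_square)

text \<open>Smoothness is given for the square; \<open>F\<close> is recovered as its square root,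
  which is differentiable because \<open>F\<close> is positive on \<open>S\<close>.\<close>

lemma Fc_differentiable:
  assumes p: "p \<in> S" shows "Fc differentiable at p"
proof -
  obtain D where "((\<lambda>q. (F q)\<^sup>2) has_derivative D) (at p)"
    using smooth_on_differentiable[OF smooth, of p] p by (auto simp: S_def differentiable_def)
  moreover have "(F p)\<^sup>2 > 0"
    using F_pos[OF p] by simp
  ultimately have "((\<lambda>q. sqrt ((F q)\<^sup>2)) has_derivative (\<lambda>v. inverse (sqrt ((F p)\<^sup>2)) / 2 * D v)) (at p)"
    by (intro has_derivative_compose[OF _ DERIV_real_sqrt[THEN has_field_derivative_imp_has_derivative]])
  from bounded_linear.has_derivative[OF bounded_linear_of_real this]
  have "(\<lambda>q. complex_of_real (sqrt ((F q)\<^sup>2))) differentiable at p"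
    by (rule differentiableI)
  then show ?thesis
    by (rule differentiable_cong_open[OF open_S p, rotated]) (simp add: F_pos abs_of_pos del: split_paired_All)
qed

lemma det_differentiable: "p \<in> S \<Longrightarrow> (\<lambda>q. det (gmat F q)) differentiable at p"
  unfolding det_gmat by (intro differentiable_diff differentiable_mult gm_differentiable)

lemma sqrt_g_differentiable:
  assumes p: "p \<in> S" shows "sqrt_g F differentiable at p"
proof -
  obtain D where "((\<lambda>q. det (gmat F q)) has_derivative D) (at p)"
    using det_differentiable[OF p] by (auto simp: differentiable_def)
  \<comment> \<open>The principal root is differentiable off the nonpositive reals, and the
    determinant is a positive real.\<close>
  moreover have "det (gmat F p) \<notin> \<real>\<^sub>\<le>\<^sub>0"
    using det_pos[OF p] by (auto simp: complex_nonpos_Reals_iff)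
  ultimately have "((\<lambda>q. csqrt (det (gmat F q))) has_derivative (\<lambda>v. inverse (2 * csqrt (det (gmat F p))) * D v)) (at p)"
    by (intro has_derivative_compose[OF _ has_field_derivative_csqrt[THEN has_field_derivative_imp_has_derivative]])
  then show ?thesis
    unfolding sqrt_g_def[abs_def] differentiable_def by blast
qed

lemma sqrt_g_nonzero: "p \<in> S \<Longrightarrow> sqrt_g F p \<noteq> 0"
  using sqrt_g_square[of p] det_nonzero[of p] by auto

lemma ginv_differentiable:
  assumes p: "p \<in> S" shows "ginv F m i differentiable at p"
proof -
  have *: "(\<lambda>q. c * gm F a b q / det (gmat F q)) differentiable at p" for c a b
    by (intro differentiable_divide differentiable_mult det_differentiable gm_differentiable p det_nonzero
        differentiable_const)
  have **: "ginv F m i differentiable at p" if "\<And>q. q \<in> S \<Longrightarrow> c * gm F a b q / det (gmat F q) = ginv F m i q" for c a b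
    by (rule differentiable_cong_open[OF open_S p that *])
  show ?thesis
    by (rule two_cases[of m]; rule two_cases[of i])
       (use **[of 1 2 2] **[of "-1" 1 2] **[of "-1" 2 1] **[of 1 1 1] in \<open>simp_all add: ginv_eq\<close>)
qed

lemma Nc_differentiable: "p \<in> S \<Longrightarrow> Nc F k j differentiable at p"
  unfolding Nc_def[abs_def]
  by (intro differentiable_sum finite ballI differentiable_mult ginv_differentiable gm_differentiable differentiable_snd_nth)

lemma Lc_differentiable: "p \<in> S \<Longrightarrow> Lc F i j k differentiable at p"
  unfolding Lc_def[abs_def] del_def[abs_def]
  by (intro differentiable_sum differentiable_diff finite ballI differentiable_mult
      ginv_differentiable gm_differentiable Nc_differentiable)

lemma l_up_differentiable: "p \<in> S \<Longrightarrow> l_up F i differentiable at p"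
  unfolding l_up_def[abs_def] by (intro differentiable_divide Fc_differentiable Fc_nonzero differentiable_snd_nth)

lemma l_low_differentiable: "p \<in> S \<Longrightarrow> l_low F i differentiable at p"
  unfolding l_low_def[abs_def]
  by (intro differentiable_sum finite ballI differentiable_mult differentiable_divide Fc_differentiable Fc_nonzero
      differentiable_const gm_differentiable differentiable_cnj differentiable_snd_nth)

lemma m_up_differentiable: "p \<in> S \<Longrightarrow> m_up F i differentiable at p"
  unfolding m_up_def[abs_def]
  by (cases "i = 1") (auto intro!: differentiable_divide differentiable_minus l_low_differentiable
      sqrt_g_differentiable simp: sqrt_g_nonzero)

lemma m_low_differentiable: "p \<in> S \<Longrightarrow> m_low F i differentiable at p"
  unfolding m_low_def[abs_def]
  by (cases "i = 1") (auto intro!: differentiable_mult differentiable_minus l_up_differentiable sqrt_g_differentiable)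

section \<open>Contractions of the connection coefficients\<close>

lemma deta_L:
  assumes p: "p \<in> S" shows "deta j L p = (\<Sum>n\<in>UNIV. gm F j n p * cnj (snd p $ n))"
proof -
  have "deta j (\<lambda>q. cnj (L q)) p = cnj (detabar j L p)"
    by (rule wirtinger_cnj(3)[OF L_differentiable[OF p]])
  moreover have "(\<lambda>q. cnj (L q)) = L" by (simp add: L_def fun_eq_iff)
  ultimately have "deta j L p = cnj (detabar j L p)" by simp
  then show ?thesis
    by (simp add: gm_eta[OF p, symmetric] gm_hermitian[OF p])
qed

lemma wirtinger_cnj_snd: "dz k (\<lambda>q. cnj (snd q $ i)) p = 0"
  by (simp add: wirtinger_cnj[OF differentiable_snd_nth] wirtinger_snd)

lemma dz_L:
  assumes p: "p \<in> S"
  shows "dz k L p = (\<Sum>i\<in>UNIV. \<Sum>j\<in>UNIV. dz k (gm F i j) p * snd p $ i * cnj (snd p $ j))"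
proof -
  note D = derivation_wirtinger(1)[of p k]
  have "dz k L p = dz k (\<lambda>q. \<Sum>i\<in>UNIV. \<Sum>j\<in>UNIV. gm F i j q * snd q $ i * cnj (snd q $ j)) p"
    by (rule derivation_cong_open[OF D open_S p L_eq])
  also have "\<dots> = (\<Sum>i\<in>UNIV. \<Sum>j\<in>UNIV. dz k (gm F i j) p * snd p $ i * cnj (snd p $ j))"
    by (simp add: derivation_sum[OF D] derivation_mult[OF D] differentiable_sum differentiable_mult
        gm_differentiable[OF p] differentiable_snd_nth differentiable_cnj wirtinger_snd wirtinger_cnj_snd)
  finally show ?thesis .
qed

text \<open>Both \<open>Nc\<close> and \<open>Lc\<close> arise by raising the index of some a with
  the inverse metric; lowering it again gives back a.\<close>

lemma ginv_contract:
  assumes p: "p \<in> S"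
  shows "(\<Sum>i\<in>UNIV. gm F i r p * (\<Sum>m\<in>UNIV. ginv F m i p * a m)) = a r"
proof -
  have "(\<Sum>i\<in>UNIV. gm F i r p * (\<Sum>m\<in>UNIV. ginv F m i p * a m))
      = (\<Sum>m\<in>UNIV. (\<Sum>i\<in>UNIV. gm F i r p * ginv F m i p) * a m)"
    by (simp add: sum_2 algebra_simps)
  also have "\<dots> = a r"
    unfolding ginv_gm[OF p] by (rule two_cases[of r]) (simp_all add: sum_2)
  finally show ?thesis .
qed

lemma Nc_gm:
  assumes p: "p \<in> S"
  shows "(\<Sum>j\<in>UNIV. gm F j n p * Nc F j k p) = (\<Sum>l\<in>UNIV. dz k (gm F l n) p * snd p $ l)"
proof -
  have "Nc F j k p = (\<Sum>m\<in>UNIV. ginv F m j p * (\<Sum>l\<in>UNIV. dz k (gm F l m) p * snd p $ l))" for j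
    by (simp add: Nc_def sum_distrib_left mult.assoc)
  then show ?thesis by (simp only: ginv_contract[OF p])
qed

lemma Lc_gm:
  assumes p: "p \<in> S"
  shows "(\<Sum>i\<in>UNIV. gm F i r p * Lc F i j k p) = del F k (gm F j r) p"
  unfolding Lc_def by (rule ginv_contract[OF p])

text \<open>The vertical part of \<open>del F k (gm F j l)\<close> disappears on contraction with
  \<eta> by \<open>deta_gm_eta\<close>; what remains is the definition of \<open>Nc\<close>.\<close>

lemma Lc_eta:
  assumes p: "p \<in> S" shows "(\<Sum>j\<in>UNIV. Lc F i j k p * snd p $ j) = Nc F i k p"
proof -
  have *: "(\<Sum>j\<in>UNIV. del F k (gm F j l) p * snd p $ j) = (\<Sum>j\<in>UNIV. dz k (gm F j l) p * snd p $ j)" for l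
  proof -
    have "(\<Sum>j\<in>UNIV. del F k (gm F j l) p * snd p $ j) = (\<Sum>j\<in>UNIV. dz k (gm F j l) p * snd p $ j)
      - (\<Sum>m\<in>UNIV. Nc F m k p * (\<Sum>j\<in>UNIV. deta m (gm F j l) p * snd p $ j))"
      by (simp add: del_def sum_2 algebra_simps)
    then show ?thesis by (simp add: deta_gm_eta[OF p])
  qed
  have "(\<Sum>j\<in>UNIV. Lc F i j k p * snd p $ j)
      = (\<Sum>l\<in>UNIV. ginv F l i p * (\<Sum>j\<in>UNIV. del F k (gm F j l) p * snd p $ j))"
    by (simp add: Lc_def sum_2 algebra_simps)
  also have "\<dots> = Nc F i k p"
    unfolding * by (simp add: Nc_def sum_2 algebra_simps)
  finally show ?thesis .
qed

section \<open>Action of \<open>delbar\<close> on the metric and the frame\<close>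

lemma delbar_L:
  assumes p: "p \<in> S" shows "delbar F k L p = 0"
proof -
  \<comment> \<open>The vertical part of \<open>del F k L\<close> cancels \<open>dz k L\<close>, by
    lowering the index of \<open>Nc\<close>. Since L is real, conjugation then yields the claim for
    \<open>delbar\<close>.\<close>
  have "(\<Sum>j\<in>UNIV. Nc F j k p * deta j L p)
      = (\<Sum>n\<in>UNIV. (\<Sum>j\<in>UNIV. gm F j n p * Nc F j k p) * cnj (snd p $ n))"
    unfolding deta_L[OF p] by (simp add: sum_2 algebra_simps)
  also have "\<dots> = dz k L p"
    unfolding Nc_gm[OF p] dz_L[OF p] by (simp add: sum_2 algebra_simps)
  finally have "del F k L p = 0" by (simp add: del_def)
  moreover have "(\<lambda>q. cnj (L q)) = L" by (simp add: L_def fun_eq_iff)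
  ultimately show ?thesis
    using delbar_cnj[OF L_differentiable[OF p], of F k] by simp
qed

lemma delbar_Fc:
  assumes p: "p \<in> S" shows "delbar F k Fc p = 0"
proof -
  have "delbar F k (\<lambda>q. Fc q * Fc q) p = 0"
    unfolding Fc_square using delbar_L[OF p] .
  then show ?thesis
    by (simp add: derivation_mult[OF derivation_delbar] Fc_differentiable[OF p] Fc_nonzero[OF p])
       (use F_pos[OF p] in simp)
qed

lemma Fc_l_up: "q \<in> S \<Longrightarrow> Fc q * l_up F i q = snd q $ i"
  using Fc_nonzero[of q] by (simp add: l_up_def)

lemma Fc_l_low: "q \<in> S \<Longrightarrow> Fc q * l_low F i q = (\<Sum>j\<in>UNIV. gm F i j q * cnj (snd q $ j))"
  using Fc_nonzero[of q] by (simp add: l_low_def)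

lemma delbar_Fc_mult:
  assumes p: "p \<in> S" and f: "f differentiable at p"
  shows "delbar F k (\<lambda>q. Fc q * f q) p = Fc p * delbar F k f p"
  by (simp add: derivation_mult[OF derivation_delbar] Fc_differentiable[OF p] f delbar_Fc[OF p])

text \<open>Instead of a quotient, the product of F and \<open>l_up\<close>, which is \<eta>, is
  differentiated: \<open>delbar\<close> annihilates both F and \<eta>.\<close>

lemma delbar_l_up:
  assumes p: "p \<in> S" shows "delbar F k (l_up F i) p = 0"
proof -
  have "delbar F k (\<lambda>q. Fc q * l_up F i q) p = delbar F k (\<lambda>q. snd q $ i) p"
    by (rule derivation_cong_open[OF derivation_delbar open_S p Fc_l_up])
  then have "Fc p * delbar F k (l_up F i) p = 0"
    by (simp only: delbar_Fc_mult[OF p l_up_differentiable[OF p]] del_snd)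
  then show ?thesis using Fc_nonzero[OF p] by simp
qed

text \<open>\<open>Lc_gm\<close> is the compatibility of the connection with the metric; Hermitian
  symmetry and conjugation transport it to \<open>delbar\<close>.\<close>

lemma delbar_gm:
  assumes p: "p \<in> S"
  shows "delbar F k (gm F i j) p = (\<Sum>r\<in>UNIV. gm F i r p * cnj (Lc F r j k p))"
proof -
  have "delbar F k (gm F i j) p = delbar F k (\<lambda>q. cnj (gm F j i q)) p"
    by (rule derivation_cong_open[OF derivation_delbar open_S p]) (simp add: gm_hermitian)
  also have "\<dots> = cnj (\<Sum>r\<in>UNIV. gm F r i p * Lc F r j k p)"
    unfolding Lc_gm[OF p] by (rule delbar_cnj[OF gm_differentiable(1)[OF p]])
  finally show ?thesis by (simp add: gm_hermitian[OF p])
qed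

text \<open>The derivative of the metric and that of the conjugate of \<eta> cancel, because
  \<open>Lc\<close> contracted with \<eta> is \<open>Nc\<close>.\<close>

lemma delbar_l_low:
  assumes p: "p \<in> S" shows "delbar F k (l_low F i) p = 0"
proof -
  note D = derivation_delbar[of p F k]
  have "delbar F k (\<lambda>q. Fc q * l_low F i q) p = delbar F k (\<lambda>q. \<Sum>j\<in>UNIV. gm F i j q * cnj (snd q $ j)) p"
    by (rule derivation_cong_open[OF D open_S p Fc_l_low])
  also have "\<dots> = (\<Sum>j\<in>UNIV. delbar F k (gm F i j) p * cnj (snd p $ j) - gm F i j p * cnj (Nc F j k p))"
    by (simp add: derivation_sum[OF D] derivation_mult[OF D] differentiable_mult
        gm_differentiable[OF p] differentiable_snd_nth differentiable_cnj delbar_cnj del_snd)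
  also have "\<dots> = 0"
    unfolding Lc_eta[OF p, symmetric] delbar_gm[OF p] by (simp add: sum_2 algebra_simps)
  finally have "Fc p * delbar F k (l_low F i) p = 0"
    by (simp only: delbar_Fc_mult[OF p l_low_differentiable[OF p]])
  then show ?thesis using Fc_nonzero[OF p] by simp
qed

text \<open>By \<open>delbar_sqrt_g\<close> this is the logarithmic derivative of
  \<open>sqrt_g\<close>.\<close>

definition cov_trace :: "2 \<Rightarrow> point \<Rightarrow> complex" where
  "cov_trace k p = cnj (\<Sum>s\<in>UNIV. Lc F s s k p) / 2"

text \<open>Differentiating the determinant gives the full trace, as in Jacobi's formula; passing to
  the square root halves it.\<close>

lemma delbar_sqrt_g:
  assumes p: "p \<in> S" shows "delbar F k (sqrt_g F) p = cov_trace k p * sqrt_g F p"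
proof -
  note D = derivation_delbar[of p F k]
  have "delbar F k (\<lambda>q. sqrt_g F q * sqrt_g F q) p = cnj (\<Sum>s\<in>UNIV. Lc F s s k p) * det (gmat F p)"
    unfolding sqrt_g_square det_gmat
    by (simp add: derivation_diff[OF D] derivation_mult[OF D] differentiable_mult
        gm_differentiable[OF p] delbar_gm[OF p] sum_2 algebra_simps)
  also have "\<dots> = 2 * sqrt_g F p * (cov_trace k p * sqrt_g F p)"
    unfolding sqrt_g_square[symmetric] by (simp add: cov_trace_def)
  also have "delbar F k (\<lambda>q. sqrt_g F q * sqrt_g F q) p = 2 * sqrt_g F p * delbar F k (sqrt_g F) p"
    by (simp add: derivation_mult[OF D] sqrt_g_differentiable[OF p])
  finally show ?thesis using sqrt_g_nonzero[OF p] by simp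
qed

lemma sqrt_g_m_up:
  "q \<in> S \<Longrightarrow> sqrt_g F q * m_up F i q = (if i = 1 then - l_low F 2 q else l_low F 1 q)"
  using sqrt_g_nonzero[of q] by (simp add: m_up_def)

text \<open>Up to sign, \<open>sqrt_g\<close> times \<open>m_up\<close> is a component of
  \<open>l_low\<close>, which \<open>delbar\<close> annihilates; so \<open>m_up\<close> takes the
  factor opposite to that of \<open>sqrt_g\<close>.\<close>

lemma delbar_m_up:
  assumes p: "p \<in> S" shows "delbar F k (m_up F i) p = - cov_trace k p * m_up F i p"
proof -
  note D = derivation_delbar[of p F k]
  have "delbar F k (\<lambda>q. sqrt_g F q * m_up F i q) p
      = delbar F k (\<lambda>q. if i = 1 then - l_low F 2 q else l_low F 1 q) p"
    by (rule derivation_cong_open[OF D open_S p sqrt_g_m_up])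
  also have "\<dots> = 0"
    by (cases "i = 1") (simp_all add: derivation_minus[OF D] delbar_l_low[OF p] l_low_differentiable[OF p])
  finally have "sqrt_g F p * (delbar F k (m_up F i) p + cov_trace k p * m_up F i p) = 0"
    by (simp add: derivation_mult[OF D] sqrt_g_differentiable[OF p] m_up_differentiable[OF p]
        delbar_sqrt_g[OF p] algebra_simps)
  then show ?thesis using sqrt_g_nonzero[OF p] by (simp add: add_eq_0_iff2)
qed

lemma delbar_m_low:
  assumes p: "p \<in> S" shows "delbar F k (m_low F i) p = cov_trace k p * m_low F i p"
  unfolding m_low_def[abs_def]
  by (cases "i = 1") (simp_all add: derivation_mult[OF derivation_delbar] derivation_minus[OF derivation_delbar]
      differentiable_mult sqrt_g_differentiable[OF p] l_up_differentiable[OF p] delbar_sqrt_g[OF p] delbar_l_up[OF p])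

subsection \<open>The curvature in the frame\<close>

text \<open>Leibniz rule for eigenvectors of \<open>delbar\<close>: the eigenvalues add up. With a
  for \<open>cov_trace\<close> they are 0, 0, 0 for J, then 0, -a, a for E, and -a, -a, a for
  H.\<close>

lemma delbar_Lc_contraction:
  assumes p: "p \<in> S"
    and a: "\<And>j. a j differentiable at p" "\<And>j. delbar F h (a j) p = \<alpha> * a j p"
    and b: "\<And>j. b j differentiable at p" "\<And>j. delbar F h (b j) p = \<beta> * b j p"
    and c: "\<And>j. c j differentiable at p" "\<And>j. delbar F h (c j) p = \<gamma> * c j p"
  shows "delbar F h (\<lambda>q. \<Sum>j\<in>UNIV. \<Sum>k\<in>UNIV. \<Sum>i\<in>UNIV. a j q * b k q * c i q * Lc F i j k q) p
    = (\<Sum>j\<in>UNIV. \<Sum>k\<in>UNIV. \<Sum>i\<in>UNIV. a j p * b k p * c i p * delbar F h (Lc F i j k) p)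
    + (\<alpha> + \<beta> + \<gamma>) * (\<Sum>j\<in>UNIV. \<Sum>k\<in>UNIV. \<Sum>i\<in>UNIV. a j p * b k p * c i p * Lc F i j k p)"
proof -
  note D = derivation_delbar[of p F h]
  have "delbar F h (\<lambda>q. a j q * b k q * c i q * Lc F i j k q) p
      = a j p * b k p * c i p * delbar F h (Lc F i j k) p
        + (\<alpha> + \<beta> + \<gamma>) * (a j p * b k p * c i p * Lc F i j k p)" for i j k
    by (simp add: derivation_mult[OF D] differentiable_mult Lc_differentiable[OF p] a b c algebra_simps)
  then show ?thesis
    by (simp add: derivation_sum[OF D] differentiable_sum differentiable_mult Lc_differentiable[OF p]
        a(1) b(1) c(1) sum.distrib sum_distrib_left)
qed

section \<open>Duality and lowering of indices in the frame\<close>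

lemma l_up_l_low:
  assumes p: "p \<in> S" shows "(\<Sum>i\<in>UNIV. l_up F i p * l_low F i p) = 1"
proof -
  have "(\<Sum>i\<in>UNIV. (Fc p * l_up F i p) * (Fc p * l_low F i p)) = Fc p * Fc p"
    unfolding Fc_l_up[OF p] Fc_l_low[OF p] Fc_square L_eq[OF p] by (simp add: sum_2 algebra_simps)
  then have "(Fc p * Fc p) * (\<Sum>i\<in>UNIV. l_up F i p * l_low F i p) = (Fc p * Fc p) * 1"
    by (simp add: sum_2 algebra_simps)
  then show ?thesis using Fc_nonzero[OF p] by (simp only: mult_cancel_left) simp
qed

text \<open>Off the diagonal the two products cancel. On it, m^1 m_1 = l^2 l_2 and m^2 m_2 = l^1
  l_1, so both entries equal the full contraction of \<open>l_up\<close> with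
  \<open>l_low\<close>.\<close>

lemma frame_resolution:
  assumes p: "p \<in> S"
  shows "l_up F i p * l_low F j p + m_up F i p * m_low F j p = (if i = j then 1 else 0)"
  by (rule two_cases[of i]; rule two_cases[of j])
     (use l_up_l_low[OF p] sqrt_g_nonzero[OF p] in
       \<open>simp_all add: m_up_def m_low_def sum_2 mult.commute add.commute\<close>)

lemma cnj_l_low:
  assumes p: "p \<in> S" shows "cnj (l_low F i p) = (\<Sum>j\<in>UNIV. gm F j i p * l_up F j p)"
  by (simp add: l_low_def l_up_def gm_hermitian[OF p] sum_2 add_divide_distrib)

lemma gm_cnj_l_up:
  "(\<Sum>r\<in>UNIV. gm F i r p * cnj (l_up F r p)) = l_low F i p"
  by (simp add: l_low_def l_up_def sum_2 add_divide_distrib)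

lemma gm_cnj_m_up:
  assumes p: "p \<in> S" shows "(\<Sum>r\<in>UNIV. gm F i r p * cnj (m_up F r p)) = m_low F i p"
proof -
  have "sqrt_g F p * (\<Sum>r\<in>UNIV. gm F i r p * cnj (m_up F r p))
      = (\<Sum>r\<in>UNIV. gm F i r p * cnj (sqrt_g F p * m_up F r p))"
    by (simp add: sum_2 sqrt_g_real[OF p] algebra_simps)
  \<comment> \<open>Once the conjugate of \<open>l_low\<close> is written through
    \<open>l_up\<close>, one component cancels and the metric entries before the other combine to
    the determinant.\<close>
  also have "\<dots> = sqrt_g F p * sqrt_g F p * (if i = 1 then - l_up F 2 p else l_up F 1 p)"
    unfolding sqrt_g_m_up[OF p] sqrt_g_square det_gmat
    by (rule two_cases[of i]) (simp_all add: sum_2 cnj_l_low[OF p] algebra_simps)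
  also have "\<dots> = sqrt_g F p * m_low F i p"
    by (simp add: m_low_def)
  finally show ?thesis using sqrt_g_nonzero[OF p] by simp
qed

text \<open>This makes the torsion part of the curvature vanish along l.\<close>

lemma Cc_eta_left:
  assumes p: "p \<in> S" shows "(\<Sum>j\<in>UNIV. Cc F i j k p * snd p $ j) = 0"
proof -
  have "(\<Sum>j\<in>UNIV. Cc F i j k p * snd p $ j)
      = (\<Sum>l\<in>UNIV. ginv F l i p * (\<Sum>j\<in>UNIV. deta k (gm F j l) p * snd p $ j))"
    by (simp add: Cc_def sum_2 algebra_simps)
  then show ?thesis by (simp add: deta_gm_eta[OF p])
qed

text \<open>Here the differentiation index is contracted, so degree 0 of the metric is used. Along m
  this removes the l component of the torsion.\<close>

lemma Cc_eta_right:
  assumes p: "p \<in> S" shows "(\<Sum>k\<in>UNIV. Cc F i j k p * snd p $ k) = 0"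
proof -
  have "(\<Sum>k\<in>UNIV. Cc F i j k p * snd p $ k)
      = (\<Sum>l\<in>UNIV. ginv F l i p * (\<Sum>k\<in>UNIV. deta k (gm F j l) p * snd p $ k))"
    by (simp add: Cc_def sum_2 algebra_simps)
  then show ?thesis by (simp add: euler_gm[OF p])
qed

lemma Cc_l_up_left:
  assumes p: "p \<in> S" shows "(\<Sum>j\<in>UNIV. Cc F i j k p * l_up F j p) = 0"
  using Cc_eta_left[OF p, of i k] by (simp add: l_up_def flip: sum_divide_distrib)

lemma Cc_l_up_right:
  assumes p: "p \<in> S" shows "(\<Sum>k\<in>UNIV. Cc F i j k p * l_up F k p) = 0"
  using Cc_eta_right[OF p, of i j] by (simp add: l_up_def flip: sum_divide_distrib)

text \<open>The grouping isolates the torsion: \<open>Cc\<close> contracted with a and c is a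
  covector in s, paired with the derivative of \<open>Nc\<close>.\<close>

lemma curv_contraction:
  fixes a b c :: "2 \<Rightarrow> complex"
  shows "(\<Sum>j\<in>UNIV. \<Sum>k\<in>UNIV. \<Sum>i\<in>UNIV. a j * b k * c i * curv F i j h k p)
    = - (\<Sum>j\<in>UNIV. \<Sum>k\<in>UNIV. \<Sum>i\<in>UNIV. a j * b k * c i * delbar F h (Lc F i j k) p)
      - (\<Sum>s\<in>UNIV. (\<Sum>k\<in>UNIV. b k * delbar F h (Nc F s k) p)
          * (\<Sum>i\<in>UNIV. c i * (\<Sum>j\<in>UNIV. Cc F i j s p * a j)))"
  unfolding curv_def sum_2 by (simp add: algebra_simps)

section \<open>The curvature along \<lambda>\<close>

lemma curv_l_contraction:
  assumes p: "p \<in> S"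
  shows "(\<Sum>j\<in>UNIV. \<Sum>k\<in>UNIV. \<Sum>i\<in>UNIV. l_up F j p * l_up F k p * l_low F i p * curv F i j h k p)
    = - delbar F h (J_inv F) p"
proof -
  have "delbar F h (J_inv F) p
    = (\<Sum>j\<in>UNIV. \<Sum>k\<in>UNIV. \<Sum>i\<in>UNIV. l_up F j p * l_up F k p * l_low F i p * delbar F h (Lc F i j k) p)"
    unfolding J_inv_def[abs_def]
    using delbar_Lc_contraction[OF p, of "l_up F" h 0 "l_up F" 0 "l_low F" 0]
    by (simp add: l_up_differentiable[OF p] l_low_differentiable[OF p] delbar_l_up[OF p] delbar_l_low[OF p])
  then show ?thesis
    unfolding curv_contraction Cc_l_up_left[OF p] by simp
qed

lemma K_lambda_eq:
  assumes p: "p \<in> S" shows "K_lambda F p = 2 * bold_K F p"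
proof -
  \<comment> \<open>Summing over r first turns the conjugate of \<open>l_up\<close> into
    \<open>l_low\<close>. The sum over h stays outside; its weight, the conjugate of \<eta> over F,
    accounts for the factor 1/F in \<open>bold_K\<close>.\<close>
  have "K_lambda F p = 2 * (\<Sum>h\<in>UNIV. cnj (l_up F h p) * (\<Sum>j\<in>UNIV. \<Sum>k\<in>UNIV. \<Sum>i\<in>UNIV.
      l_up F j p * l_up F k p * (\<Sum>r\<in>UNIV. gm F i r p * cnj (l_up F r p)) * curv F i j h k p))"
    unfolding K_lambda_def curv_low_def sum_2 by (simp add: algebra_simps)
  also have "\<dots> = 2 * bold_K F p"
    unfolding gm_cnj_l_up curv_l_contraction[OF p]
    by (simp add: bold_K_def del0bar_def l_up_def sum_2 add_divide_distrib algebra_simps)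
  finally show ?thesis .
qed

section \<open>The curvature along \<mu>\<close>

lemma delbar_E_inv:
  assumes p: "p \<in> S"
  shows "Fc p * delbar F h (E_inv F) p
    = (\<Sum>s\<in>UNIV. (\<Sum>k\<in>UNIV. m_up F k p * delbar F h (Nc F s k) p) * m_low F s p)"
proof -
  note D = derivation_delbar[of p F h]
  \<comment> \<open>\<open>delbar\<close> annihilates \<eta>, so the derivative falls on
    \<open>Lc\<close> alone. Since \<eta> is F times \<open>l_up\<close>, this is the origin of the
    factor F before the derivative of E.\<close>
  have N: "delbar F h (Nc F s k) p = (\<Sum>j\<in>UNIV. delbar F h (Lc F s j k) p * snd p $ j)" for s k
  proof -
    have "delbar F h (Nc F s k) p = delbar F h (\<lambda>q. \<Sum>j\<in>UNIV. Lc F s j k q * snd q $ j) p"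
      by (rule derivation_cong_open[OF D open_S p]) (simp add: Lc_eta)
    also have "\<dots> = (\<Sum>j\<in>UNIV. delbar F h (Lc F s j k) p * snd p $ j)"
      by (simp add: derivation_sum[OF D] derivation_mult[OF D] differentiable_mult
        Lc_differentiable[OF p] differentiable_snd_nth del_snd)
    finally show ?thesis .
  qed
  \<comment> \<open>The eigenvalues of \<open>m_up\<close> and \<open>m_low\<close> cancel.\<close>
  have "delbar F h (E_inv F) p
    = (\<Sum>j\<in>UNIV. \<Sum>k\<in>UNIV. \<Sum>i\<in>UNIV. l_up F j p * m_up F k p * m_low F i p * delbar F h (Lc F i j k) p)"
    unfolding E_inv_def[abs_def]
    using delbar_Lc_contraction[OF p, of "l_up F" h 0 "m_up F" "- cov_trace h p" "m_low F" "cov_trace h p"]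
    by (simp add: l_up_differentiable[OF p] m_up_differentiable[OF p] m_low_differentiable[OF p]
        delbar_l_up[OF p] delbar_m_up[OF p] delbar_m_low[OF p])
  then show ?thesis
    unfolding N Fc_l_up[OF p, symmetric] sum_2 by (simp add: algebra_simps)
qed

text \<open>Inserts the identity \<open>frame_resolution\<close> between x and y, so that a
  contraction splits into its l and m components.\<close>

lemma frame_contraction:
  assumes p: "p \<in> S"
  shows "(\<Sum>s\<in>UNIV. x s * y s) = (\<Sum>s\<in>UNIV. x s * l_low F s p) * (\<Sum>s\<in>UNIV. y s * l_up F s p)
    + (\<Sum>s\<in>UNIV. x s * m_low F s p) * (\<Sum>s\<in>UNIV. y s * m_up F s p)"
proof -
  have "(\<Sum>s\<in>UNIV. x s * l_low F s p) * (\<Sum>s\<in>UNIV. y s * l_up F s p)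
    + (\<Sum>s\<in>UNIV. x s * m_low F s p) * (\<Sum>s\<in>UNIV. y s * m_up F s p)
    = (\<Sum>s\<in>UNIV. \<Sum>t\<in>UNIV. x s * y t * (l_up F t p * l_low F s p + m_up F t p * m_low F s p))"
    unfolding sum_2 by (simp add: algebra_simps)
  then show ?thesis unfolding frame_resolution[OF p] by (simp add: sum_2)
qed

lemma delbar_H_inv:
  assumes p: "p \<in> S"
  shows "delbar F h (H_inv F) p
    = (\<Sum>j\<in>UNIV. \<Sum>k\<in>UNIV. \<Sum>i\<in>UNIV. m_up F j p * m_up F k p * m_low F i p * delbar F h (Lc F i j k) p)
      - cov_trace h p * H_inv F p"
  unfolding H_inv_def[abs_def]
  using delbar_Lc_contraction[OF p, of "m_up F" h "- cov_trace h p" "m_up F" "- cov_trace h p" "m_low F" "cov_trace h p"]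
  by (simp add: m_up_differentiable[OF p] m_low_differentiable[OF p] delbar_m_up[OF p] delbar_m_low[OF p])

text \<open>\<open>frame_resolution\<close> splits the trace of \<open>Lc\<close> along m into its l
  part V and its m part H.\<close>

lemma cov_trace_m_up:
  assumes p: "p \<in> S"
  shows "(\<Sum>h\<in>UNIV. cnj (m_up F h p) * cov_trace h p) = (cnj (V_inv F p) + cnj (H_inv F p)) / 2"
proof -
  have "V_inv F p + H_inv F p = (\<Sum>j\<in>UNIV. \<Sum>k\<in>UNIV. \<Sum>i\<in>UNIV.
      (l_up F j p * l_low F i p + m_up F j p * m_low F i p) * m_up F k p * Lc F i j k p)"
    unfolding V_inv_def H_inv_def sum_2 by (simp add: algebra_simps)
  also have "\<dots> = (\<Sum>k\<in>UNIV. m_up F k p * (\<Sum>s\<in>UNIV. Lc F s s k p))"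
    unfolding frame_resolution[OF p] by (simp add: sum_2 algebra_simps)
  finally have "cnj (V_inv F p) + cnj (H_inv F p) = cnj (\<Sum>k\<in>UNIV. m_up F k p * (\<Sum>s\<in>UNIV. Lc F s s k p))"
    by (metis complex_cnj_add)
  then show ?thesis
    by (simp add: cov_trace_def sum_2 add_divide_distrib algebra_simps)
qed

lemma curv_m_contraction:
  assumes p: "p \<in> S"
  shows "(\<Sum>j\<in>UNIV. \<Sum>k\<in>UNIV. \<Sum>i\<in>UNIV. m_up F j p * m_up F k p * m_low F i p * curv F i j h k p)
    = - delbar F h (H_inv F) p - cov_trace h p * H_inv F p
      - B_inv F p * Fc p * delbar F h (E_inv F) p"
proof -
  \<comment> \<open>The torsion as a covector: its l component vanishes by
    \<open>Cc_l_up_right\<close> and its m component is B, so \<open>frame_contraction\<close>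
    leaves a single product.\<close>
  define y where "y s = (\<Sum>i\<in>UNIV. m_low F i p * (\<Sum>j\<in>UNIV. Cc F i j s p * m_up F j p))" for s
  have "(\<Sum>s\<in>UNIV. y s * l_up F s p)
      = (\<Sum>i\<in>UNIV. m_low F i p * (\<Sum>j\<in>UNIV. m_up F j p * (\<Sum>s\<in>UNIV. Cc F i j s p * l_up F s p)))"
    unfolding y_def sum_2 by (simp add: algebra_simps)
  then have "(\<Sum>s\<in>UNIV. y s * l_up F s p) = 0"
    by (simp add: Cc_l_up_right[OF p])
  moreover have "(\<Sum>s\<in>UNIV. y s * m_up F s p) = B_inv F p"
    unfolding y_def B_inv_def sum_2 by (simp add: algebra_simps)
  ultimately have "(\<Sum>s\<in>UNIV. (\<Sum>k\<in>UNIV. m_up F k p * delbar F h (Nc F s k) p) * y s)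
      = Fc p * delbar F h (E_inv F) p * B_inv F p"
    using frame_contraction[OF p, of "\<lambda>s. \<Sum>k\<in>UNIV. m_up F k p * delbar F h (Nc F s k) p" y]
    by (simp add: delbar_E_inv[OF p])
  then show ?thesis
    unfolding curv_contraction y_def delbar_H_inv[OF p] by (simp add: mult_ac)
qed

lemma K_mu_eq:
  assumes p: "p \<in> S" shows "K_mu F p = 2 * bold_W F p"
proof -
  have "K_mu F p = 2 * (\<Sum>h\<in>UNIV. cnj (m_up F h p) * (\<Sum>j\<in>UNIV. \<Sum>k\<in>UNIV. \<Sum>i\<in>UNIV.
      m_up F j p * m_up F k p * (\<Sum>r\<in>UNIV. gm F i r p * cnj (m_up F r p)) * curv F i j h k p))"
    unfolding K_mu_def curv_low_def sum_2 by (simp add: algebra_simps)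
  also have "\<dots> = 2 * (- delmbar F (H_inv F) p
      - (\<Sum>h\<in>UNIV. cnj (m_up F h p) * cov_trace h p) * H_inv F p
      - B_inv F p * Fc p * delmbar F (E_inv F) p)"
    unfolding gm_cnj_m_up[OF p] curv_m_contraction[OF p] unfolding delmbar_def sum_2 by (simp add: algebra_simps)
  also have "\<dots> = 2 * bold_W F p"
    unfolding cov_trace_m_up[OF p] bold_W_def by simp
  finally show ?thesis .
qed

end

subsection \<open>Charts\<close>

text \<open>Complex linearity of the Jacobians makes multiplication of components by complex numbers
  compatible across charts.\<close>

lemma frechet_derivative_holomorphic:
  assumes f: "holomorphic_map_on f S" and z: "z \<in> S"
  shows "(f has_derivative frechet_derivative f (at z)) (at z)"
    and "frechet_derivative f (at z) (a *s v) = a *s frechet_derivative f (at z) v"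
proof -
  obtain D :: "complex^2^2" where D: "(f has_derivative (\<lambda>v. D *v v)) (at z)"
    using f z unfolding holomorphic_map_on_def by blast
  then have eq: "frechet_derivative f (at z) = (\<lambda>v. D *v v)"
    by (simp add: frechet_derivative_at[symmetric])
  with D show "(f has_derivative frechet_derivative f (at z)) (at z)" by simp
  show "frechet_derivative f (at z) (a *s v) = a *s frechet_derivative f (at z) v"
    unfolding eq by (simp add: vector_scalar_commute)
qed

context
  fixes M :: "'a topology" and A :: "'a chart set"
  assumes surface: "complex_surface M A"
begin

lemma chart_openin: "c \<in> A \<Longrightarrow> openin M (fst c)"
  and chart_image_open: "c \<in> A \<Longrightarrow> open (chart_image c)"
  and chart_homeomorphic: "c \<in> A \<Longrightarrow>
    homeomorphic_map (subtopology M (fst c)) (top_of_set (chart_image c)) (snd c)"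
  and transition_holomorphic: "c \<in> A \<Longrightarrow> d \<in> A \<Longrightarrow>
    holomorphic_map_on (transition c d) (snd c ` (fst c \<inter> fst d))"
  using surface unfolding complex_surface_def by blast+

lemma chart_inj:
  assumes c: "c \<in> A" shows "inj_on (snd c) (fst c)"
proof -
  have "topspace (subtopology M (fst c)) = fst c"
    using openin_subset[OF chart_openin[OF c]] by auto
  then show ?thesis
    using homeomorphic_imp_injective_map[OF chart_homeomorphic[OF c]] by simp
qed

lemma overlap_open:
  assumes c: "c \<in> A" and d: "d \<in> A" shows "open (snd c ` (fst c \<inter> fst d))"
proof -
  have "openin (subtopology M (fst c)) (fst c \<inter> fst d)"
    using chart_openin[OF d] by (auto simp: openin_subtopology)
  then have "openin (top_of_set (chart_image c)) (snd c ` (fst c \<inter> fst d))"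
    using homeomorphic_imp_open_map[OF chart_homeomorphic[OF c]] by (auto simp: open_map_def)
  then show ?thesis using chart_image_open[OF c] openin_open_trans by blast
qed

lemma chart_inv_chart: "c \<in> A \<Longrightarrow> x \<in> fst c \<Longrightarrow> chart_inv c (snd c x) = x"
  by (simp add: chart_inj inv_into_f_f)

text \<open>Chain rule for the passage from c to e through d, an identity on the open image of the
  overlap of c and d. It gives the compatibility that \<open>tangent_space\<close> demands of
  \<open>tangent_point\<close>.\<close>

lemma transition_cocycle:
  assumes c: "c \<in> A" and d: "d \<in> A" and e: "e \<in> A" and x: "x \<in> fst c" "x \<in> fst d" "x \<in> fst e"
  shows "frechet_derivative (transition c e) (at (snd c x)) v
    = frechet_derivative (transition d e) (at (snd d x)) (frechet_derivative (transition c d) (at (snd c x)) v)"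
proof -
  let ?T = "snd c ` (fst c \<inter> fst d)"
  have t: "transition c d (snd c y) = snd d y" if "c \<in> A" "y \<in> fst c" for c d y
    using that by (simp add: transition_def chart_inv_chart)
  have "(transition c d has_derivative frechet_derivative (transition c d) (at (snd c x))) (at (snd c x))"
    using x by (intro frechet_derivative_holomorphic[OF transition_holomorphic[OF c d]]) auto
  moreover have "(transition d e has_derivative frechet_derivative (transition d e) (at (snd d x)))
      (at (transition c d (snd c x)))"
    unfolding t[OF c x(1)]
    using x by (intro frechet_derivative_holomorphic[OF transition_holomorphic[OF d e]]) auto
  ultimately have "((\<lambda>w. transition d e (transition c d w)) has_derivative
      (\<lambda>v. frechet_derivative (transition d e) (at (snd d x)) (frechet_derivative (transition c d) (at (snd c x)) v)))
      (at (snd c x))"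
    by (rule has_derivative_compose)
  then have "(transition c e has_derivative
      (\<lambda>v. frechet_derivative (transition d e) (at (snd d x)) (frechet_derivative (transition c d) (at (snd c x)) v)))
      (at (snd c x))"
  proof (rule has_derivative_transform_within_open[OF _ overlap_open[OF c d]])
    show "snd c x \<in> ?T" using x by blast
    fix w assume "w \<in> ?T"
    then obtain y where "w = snd c y" "y \<in> fst c" "y \<in> fst d" by blast
    then show "transition d e (transition c d w) = transition c e w"
      by (simp add: t c d)
  qed
  then show ?thesis by (simp add: frechet_derivative_at[symmetric])
qed

lemma frechet_derivative_transition_self:
  assumes c: "c \<in> A" and x: "x \<in> fst c"
  shows "frechet_derivative (transition c c) (at (snd c x)) v = v"
proof -
  have "((\<lambda>w. w) has_derivative (\<lambda>v. v)) (at (snd c x))"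
    by (rule has_derivative_ident)
  then have "(transition c c has_derivative (\<lambda>v. v)) (at (snd c x))"
    by (rule has_derivative_transform_within_open[OF _ chart_image_open[OF c]])
       (use x in \<open>auto simp: transition_def chart_inv_chart[OF c]\<close>)
  then show ?thesis by (simp add: frechet_derivative_at[symmetric])
qed

lemma tangent_point_in_bundle:
  assumes c: "c \<in> A" and x: "x \<in> fst c"
  shows "tangent_point A c (snd c x, \<eta>) \<in> tangent_bundle M A"
  using x openin_subset[OF chart_openin[OF c]]
  by (auto simp: tangent_point_def tangent_bundle_def tangent_space_def chart_inv_chart[OF c]
      intro: transition_cocycle[OF c])

lemma tangent_point_scale:
  assumes c: "c \<in> A" and x: "x \<in> fst c"
  shows "tangent_point A c (snd c x, a *s \<eta>)
    = (x, \<lambda>d. a *s snd (tangent_point A c (snd c x, \<eta>)) d)"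
  using x by (auto simp: tangent_point_def chart_inv_chart[OF c] fun_eq_iff
      intro!: frechet_derivative_holomorphic(2)[OF transition_holomorphic[OF c]])

lemma tangent_point_nonzero:
  assumes c: "c \<in> A" and x: "x \<in> fst c" and "\<eta> \<noteq> 0"
  shows "snd (tangent_point A c (snd c x, \<eta>)) \<noteq> (\<lambda>_. 0)"
proof
  assume "snd (tangent_point A c (snd c x, \<eta>)) = (\<lambda>_. 0)"
  \<comment> \<open>The component in c itself is \<eta>, because the transition from c to c has the
    identity as derivative.\<close>
  from fun_cong[OF this, of c] show False
    using assms by (simp add: tangent_point_def chart_inv_chart frechet_derivative_transition_self)
qed

lemma local_finsler_in_chart:
  assumes F: "complex_finsler_function M A F" and c: "c \<in> A"
  shows "local_finsler (in_chart A c F) (chart_image c)"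
proof
  have finsler: "0 \<le> F (x, v)" "F (x, v) = 0 \<longleftrightarrow> v = (\<lambda>_. 0)" "F (x, \<lambda>c. a *s v c) = cmod a * F (x, v)"
    if "(x, v) \<in> tangent_bundle M A" for x v a
    using F[unfolded complex_finsler_function_def, THEN conjunct1, THEN bspec, OF that] by simp_all
  \<comment> \<open>Makes the base point explicit, since the Finsler axioms speak of pairs of a
    point and a vector.\<close>
  have fst_tangent_point: "tangent_point A c (snd c x, \<eta>) = (x, snd (tangent_point A c (snd c x, \<eta>)))"
    if "x \<in> fst c" for x \<eta>
    using that by (simp add: tangent_point_def chart_inv_chart[OF c])
  have in_bundle: "(x, snd (tangent_point A c (snd c x, \<eta>))) \<in> tangent_bundle M A" if "x \<in> fst c" for x \<eta>
    using tangent_point_in_bundle[OF c that, of \<eta>] fst_tangent_point[OF that, of \<eta>] by simp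
  show "open (chart_image c)" by (rule chart_image_open[OF c])
  show "smooth_on (\<lambda>q. (in_chart A c F q)\<^sup>2) (chart_image c \<times> (UNIV - {0}))"
    and "\<And>q. q \<in> chart_image c \<times> (UNIV - {0}) \<Longrightarrow> hermitian_pos_def (gmat (in_chart A c F) q)"
    using F c unfolding complex_finsler_function_def by blast+
  fix z assume "z \<in> chart_image c"
  then obtain x where x: "x \<in> fst c" "z = snd c x" by blast
  show "in_chart A c F (z, t *s \<eta>) = cmod t * in_chart A c F (z, \<eta>)" for \<eta> t
    using finsler(3)[OF in_bundle[OF x(1)], of t \<eta>] fst_tangent_point[OF x(1), of \<eta>]
    by (simp add: in_chart_def x(2) tangent_point_scale[OF c x(1)])
  show "0 < in_chart A c F (z, \<eta>)" if "\<eta> \<noteq> 0" for \<eta>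
    using finsler(1,2)[OF in_bundle[OF x(1), of \<eta>]] tangent_point_nonzero[OF c x(1) that]
      fst_tangent_point[OF x(1), of \<eta>]
    by (simp add: in_chart_def x(2) less_le)
qed

end

theorem theorem4p7:
  fixes M :: "'a topology" and A :: "'a chart set"
    and F :: "'a \<times> 'a tvec \<Rightarrow> real"
    and c :: "'a chart" and z \<eta> :: "complex^2"
  assumes "complex_surface M A"
    and "complex_finsler_function M A F"
    and "c \<in> A" and "z \<in> chart_image c" and "\<eta> \<noteq> 0"
  shows "K_lambda (in_chart A c F) (z, \<eta>) = 2 * bold_K (in_chart A c F) (z, \<eta>)
    \<and> K_mu (in_chart A c F) (z, \<eta>) = 2 * bold_W (in_chart A c F) (z, \<eta>)"
proof -
  interpret local_finsler "in_chart A c F" "chart_image c"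
    using assms(1-3) by (rule local_finsler_in_chart)
  have "(z, \<eta>) \<in> S" using assms(4,5) by (simp add: S_def)
  then show ?thesis by (simp add: K_lambda_eq K_mu_eq)
qed

end
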